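(* Let $a_n>0$, $b_n\in\mathbb R$ ($n\ge 0$) satisfy, as $n\to\infty$, $$a_n=n^{\sigma}\bigl(1+\alpha n^{-1}+O(n^{-2})\bigr),\qquad b_n=2\gamma n^{\sigma}\bigl(1+\beta n^{-1}+O(n^{-2})\bigr)$$ with $\alpha,\beta\in\mathbb R$, $|\gamma|=1$ and $\sigma>3/2$. Put $\nu=-\operatorname{sgn}\gamma$, $\tau=2\beta-2\alpha+\sigma$ and $\varrho=\min\{\sigma-3/2,\,1/2\}$. Then for every $z\in\mathbb C$ the Jacobi equation $$a_{n-1}f_{n-1}(z)+b_nf_n(z)+a_nf_{n+1}(z)=zf_n(z),\qquad n\in\mathbb Z_+,$$ has a solution $\{f_n(z)\}$ with asymptotics, as $n\to\infty$, $$f_n(z)=\nu^n n^{-\sigma/2+1/4}e^{-2i\sqrt{|\tau|n}}\bigl(1+O(n^{-\varrho})\bigr)\quad\text{if }\tau<0,$$ and $$f_n(z)=\nu^n n^{-\sigma/2+1/4}e^{-2\sqrt{\tau n}}\bigl(1+O(n^{-\varrho})\bigr)\quad\text{if }\tau>0.$$ These asymptotic relations are uniform in $z$ on compact subsets of $\mathbb C$. For all $n\in\mathbb Z_+$, the functions $f_n(z)$ are entire functions of $z\in\mathbb C$ of minimal exponential type.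
   Context: $\mathbb Z_+=\{0,1,2,\dots\}$. Solutions of the Jacobi equation are sequences $\{f_n\}_{n\ge-1}$, with the convention $a_{-1}=1/2$. An entire function $F$ is of minimal exponential type if for every $\varepsilon>0$ there is a constant $C(\varepsilon)$ with $|F(z)|\le C(\varepsilon)e^{\varepsilon|z|}$ for all $z\in\mathbb C$. *)

theory Defs
  imports "HOL-Complex_Analysis.Complex_Analysis" "HOL-Library.Landau_Symbols"
begin

text \<open>Off-diagonal coefficients on indices \<open>k \<ge> -1\<close>, with the convention \<open>a\<^sub>-\<^sub>1 = 1/2\<close>.\<close>

definition jacobi_offdiag :: "(nat \<Rightarrow> real) \<Rightarrow> int \<Rightarrow> real" where
  "jacobi_offdiag a k = (if k = - 1 then 1 / 2 else a (nat k))"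

text \<open>A solution is a sequence \<open>u\<^sub>k\<close>, \<open>k \<ge> -1\<close>; the values of \<open>u\<close> at indices below \<open>-1\<close> are
  junk and do not enter the equation.\<close>

definition jacobi_solution ::
  "(nat \<Rightarrow> real) \<Rightarrow> (nat \<Rightarrow> real) \<Rightarrow> complex \<Rightarrow> (int \<Rightarrow> complex) \<Rightarrow> bool" where
  "jacobi_solution a b z u \<longleftrightarrow>
     (\<forall>n::nat. of_real (jacobi_offdiag a (int n - 1)) * u (int n - 1)
             + of_real (b n) * u (int n)
             + of_real (jacobi_offdiag a (int n)) * u (int n + 1)
             = z * u (int n))"

text \<open>\<open>f\<^sub>n(z) = g\<^sub>n (1 + O(n\<^sup>-\<^sup>\<rho>))\<close> as \<open>n \<rightarrow> \<infinity>\<close>, uniformly for \<open>z\<close> in compact sets: both the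
  threshold for \<open>n\<close> and the \<open>O\<close>-constant depend only on the compact set.\<close>

definition asymp_unif_on_compacts ::
  "(nat \<Rightarrow> complex \<Rightarrow> complex) \<Rightarrow> (nat \<Rightarrow> complex) \<Rightarrow> real \<Rightarrow> bool" where
  "asymp_unif_on_compacts f g \<rho> \<longleftrightarrow>
     (\<forall>K. compact K \<longrightarrow>
        (\<exists>(r :: nat \<Rightarrow> complex \<Rightarrow> complex) (C :: real).
           \<forall>\<^sub>F n in sequentially. \<forall>z\<in>K.
             f n z = g n * (1 + r n z) \<and> norm (r n z) \<le> C * real n powr (- \<rho>)))"

definition minimal_exponential_type :: "(complex \<Rightarrow> complex) \<Rightarrow> bool" where
  "minimal_exponential_type F \<longleftrightarrow>
     (\<forall>\<epsilon>::real. \<epsilon> > 0 \<longrightarrow> (\<exists>C::real. \<forall>z. norm (F z) \<le> C * exp (\<epsilon> * norm z)))"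

end

theory Submission
  imports Defs "HOL-Real_Asymp.Real_Asymp"
begin

text \<open>
  Write \<open>f\<^sub>n = \<nu>\<^sup>n A\<^sub>n u\<^sub>n\<close> with \<open>A\<^sub>n = n\<^sup>p exp (- 2 s \<surd>n)\<close>, \<open>p = 1/4 - \<sigma>/2\<close>, \<open>s\<^sup>2 = \<tau>\<close>, \<open>Re s \<ge> 0\<close>. The Jacobi
  equation becomes \<open>c\<^sub>n (u\<^sub>n\<^sub>+\<^sub>1 - u\<^sub>n) - c\<^sub>n\<^sub>-\<^sub>1 (u\<^sub>n - u\<^sub>n\<^sub>-\<^sub>1) = q\<^sub>n u\<^sub>n\<close> with \<open>c\<^sub>n = a\<^sub>n A\<^sub>n A\<^sub>n\<^sub>+\<^sub>1\<close> and
  \<open>q\<^sub>n = A\<^sub>n\<^sup>2 (\<nu> z - n\<^sup>\<sigma> R\<^sub>n)\<close>, where the residual \<open>R\<^sub>n\<close> of the ansatz is \<open>O(n\<^sup>-\<^sup>2)\<close>. Solutions with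
  \<open>u\<^sub>M = u\<^sub>M\<^sub>+\<^sub>1 = 1\<close> obey a discrete Volterra equation whose kernel is bounded by
  \<open>\<bar>z\<bar> m\<^sup>1\<^sup>/\<^sup>2\<^sup>-\<^sup>\<sigma> + m\<^sup>-\<^sup>3\<^sup>/\<^sup>2\<close> up to a constant, so \<open>\<bar>u\<^sub>n - 1\<bar>\<close> is controlled uniformly in \<open>M\<close> by Gronwall.
  They are polynomials in \<open>z\<close>, and Montel's theorem yields the solution as a limit for \<open>M \<rightarrow> \<infinity>\<close>.
  The bound shows that \<open>f\<^sub>n\<close> has type \<open>O(n\<^sup>3\<^sup>/\<^sup>2\<^sup>-\<^sup>\<sigma>)\<close>, and the recurrence makes all \<open>f\<^sub>n\<close> have the
  same type. For \<open>\<tau> = 0\<close> no asymptotics is claimed and the zero solution suffices.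
\<close>

section \<open>Discrete Volterra equations\<close>

lemma summation_by_parts:
  fixes t e :: "nat \<Rightarrow> 'a::comm_ring"
  assumes "n \<le> m"
  shows "(\<Sum>k\<in>{n..<m}. t k * (e (Suc k) - e k))
       = t m * e m - t n * e n - (\<Sum>k\<in>{n..<m}. (t (Suc k) - t k) * e (Suc k))"
  using assms by (induction m rule: dec_induct) (auto simp: algebra_simps)

text \<open>Abel summation moves the differences from \<open>e\<close> to \<open>t\<close>: the two
  boundary terms cost \<open>2 * T\<close>, the remaining sum costs the variation \<open>V\<close>.
  An oscillating \<open>e\<close> of constant modulus is thus summed without a factor
  \<open>m - n\<close>.\<close>

lemma norm_sum_by_parts_le:
  fixes t e :: "nat \<Rightarrow> complex"
  assumes "n \<le> m"
    and e: "\<And>k. n \<le> k \<Longrightarrow> k \<le> m \<Longrightarrow> norm (e k) \<le> norm (e m)"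
    and t: "\<And>k. n \<le> k \<Longrightarrow> norm (t k) \<le> T"
    and V: "(\<Sum>k\<in>{n..<m}. norm (t (Suc k) - t k)) \<le> V"
  shows "norm (\<Sum>k\<in>{n..<m}. t k * (e (Suc k) - e k)) \<le> (2 * T + V) * norm (e m)"
proof -
  have "norm (t m * e m) \<le> T * norm (e m)"
    using t[OF \<open>n \<le> m\<close>] by (simp add: norm_mult mult_right_mono)
  moreover have "norm (t n * e n) \<le> T * norm (e m)"
    unfolding norm_mult using t[of n] e[of n] \<open>n \<le> m\<close>
    by (intro mult_mono) (auto intro: order_trans[OF norm_ge_zero])
  moreover have "norm (\<Sum>k\<in>{n..<m}. (t (Suc k) - t k) * e (Suc k)) \<le> V * norm (e m)"
  proof -
    have "norm (\<Sum>k\<in>{n..<m}. (t (Suc k) - t k) * e (Suc k))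
        \<le> (\<Sum>k\<in>{n..<m}. norm (t (Suc k) - t k) * norm (e m))"
      by (intro sum_norm_le) (auto simp: norm_mult intro!: mult_left_mono e)
    also have "\<dots> \<le> V * norm (e m)"
      using V by (simp flip: sum_distrib_right add: mult_right_mono)
    finally show ?thesis .
  qed
  ultimately show ?thesis
    unfolding summation_by_parts[OF \<open>n \<le> m\<close>]
    by (intro order_trans[OF norm_triangle_ineq4] order_trans[OF add_mono[OF norm_triangle_ineq4 order_refl]])
       (simp add: algebra_simps)
qed

text \<open>The divergence form is summed twice, downwards from \<open>M\<close>, where the
  difference of \<open>u\<close> vanishes and its value is 1. Collecting the double sum by
  \<open>m\<close> produces the partial sums of \<open>1 / c\<close> as kernel.\<close>

lemma volterra_equation:
  fixes c q u :: "nat \<Rightarrow> complex"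
  assumes rec: "\<And>n. N < n \<Longrightarrow> n \<le> M \<Longrightarrow>
      c n * (u (Suc n) - u n) - c (n - 1) * (u n - u (n - 1)) = q n * u n"
    and end_vals: "u M = 1" "u (Suc M) = 1"
    and c: "\<And>n. N \<le> n \<Longrightarrow> c n \<noteq> 0"
    and n: "N \<le> n" "n \<le> M"
  shows "u n = 1 + (\<Sum>m\<in>{n<..M}. (\<Sum>k\<in>{n..<m}. 1 / c k) * q m * u m)"
proof -
  \<comment> \<open>The first summation; at \<open>M\<close> both sides are 0 because
    \<open>u M = u (Suc M)\<close>.\<close>
  have D: "c n * (u (Suc n) - u n) = - (\<Sum>m\<in>{n<..M}. q m * u m)" if "n \<le> M" "N \<le> n" for n
    using that
  proof (induction n rule: inc_induct)
    case base
    then show ?case by (simp add: end_vals)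
  next
    case (step n)
    have "{n<..M} = insert (Suc n) {Suc n<..M}" using step.hyps by auto
    moreover have "c n * (u (Suc n) - u n)
        = c (Suc n) * (u (Suc (Suc n)) - u (Suc n)) - q (Suc n) * u (Suc n)"
      using rec[of "Suc n"] step by (simp add: eq_diff_eq diff_eq_eq add.commute)
    ultimately show ?case using step by simp
  qed
  show ?thesis
    using n(2,1)
  proof (induction n rule: inc_induct)
    case base
    then show ?case by (simp add: end_vals)
  next
    case (step n)
    have split: "{n<..M} = insert (Suc n) {Suc n<..M}" using step.hyps by auto
    have "u n = u (Suc n) + (\<Sum>m\<in>{n<..M}. 1 / c n * q m * u m)"
    proof -
      have "u (Suc n) - u n = - (\<Sum>m\<in>{n<..M}. q m * u m) / c n"
        using D[of n] step c[of n] by (simp add: field_simps)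
      then show ?thesis by (simp add: sum_divide_distrib field_simps)
    qed
    \<comment> \<open>For \<open>m = Suc n\<close> the kernel sum is empty, so this sum may include
      that term and merge with the previous one.\<close>
    also have "u (Suc n) = 1 + (\<Sum>m\<in>{n<..M}. (\<Sum>k\<in>{Suc n..<m}. 1 / c k) * q m * u m)"
      using step unfolding split by simp
    finally show ?case
      by (simp add: sum.atLeast_Suc_lessThan algebra_simps flip: sum.distrib)
  qed
qed

text \<open>The product \<open>p\<close> satisfies
  \<open>p n = 1 + (\<Sum>m\<in>{n<..M}. w m * p m)\<close> exactly, so it majorises
  \<open>u\<close> by induction from \<open>M\<close> downwards; then
  \<open>1 + x \<le> exp x\<close> is applied to each factor.\<close>

lemma discrete_gronwall:
  fixes u :: "nat \<Rightarrow> complex" and w :: "nat \<Rightarrow> real"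
  assumes u: "\<And>n. N \<le> n \<Longrightarrow> n \<le> M \<Longrightarrow> u n = 1 + (\<Sum>m\<in>{n<..M}. k n m * u m)"
    and k: "\<And>n m. N \<le> n \<Longrightarrow> n < m \<Longrightarrow> m \<le> M \<Longrightarrow> norm (k n m) \<le> w m"
    and n: "N \<le> n" "n \<le> M"
  shows "norm (u n - 1) \<le> exp (\<Sum>m\<in>{n<..M}. w m) - 1"
proof -
  define p where "p n = (\<Prod>m\<in>{n<..M}. 1 + w m)" for n
  have w: "0 \<le> w m" if "N < m" "m \<le> M" for m
    using k[of N m] that norm_ge_zero order_trans by blast
  have p_sum: "(\<Sum>m\<in>{n<..M}. w m * p m) = p n - 1" if "n \<le> M" for n
    using that
  proof (induction n rule: inc_induct)
    case (step n)
    have "{n<..M} = insert (Suc n) {Suc n<..M}" using step.hyps by auto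
    then show ?case using step by (simp add: p_def algebra_simps)
  qed (simp add: p_def)
  have "norm (u n - 1) \<le> p n - 1" if "N \<le> n" "n \<le> M" for n
    using that
  proof (induction "M - n" arbitrary: n rule: less_induct)
    case less
    have "norm (u n - 1) \<le> (\<Sum>m\<in>{n<..M}. w m * p m)"
      unfolding u[OF less.prems] add_diff_cancel_left'
    proof (intro sum_norm_le)
      fix m assume m: "m \<in> {n<..M}"
      have "norm (u m) \<le> p m"
        using less.hyps[of m] m less.prems norm_triangle_ineq[of "u m - 1" 1] by force
      then show "norm (k n m * u m) \<le> w m * p m"
        unfolding norm_mult using k[of n m] m less.prems w[of m] by (intro mult_mono) auto
    qed
    then show ?case using p_sum less.prems by simp
  qed
  also have "p n \<le> exp (\<Sum>m\<in>{n<..M}. w m)"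
    unfolding p_def by (subst exp_sum) (use w n in \<open>auto intro!: prod_mono exp_ge_add_one_self\<close>)
  finally show ?thesis using n by simp
qed

text \<open>Integral comparison: by the mean value theorem each term is at most the increment of an
  antiderivative over the preceding unit interval, and the increments telescope.\<close>

lemma sum_powr_tail_le:
  fixes s :: real
  assumes "s > 1" "0 < n"
  shows "(\<Sum>m\<in>{n<..M}. real m powr (- s)) \<le> real n powr (1 - s) / (s - 1)"
proof -
  have telescope: "real (Suc m) powr (- s) \<le> (real m powr (1 - s) - real (Suc m) powr (1 - s)) / (s - 1)"
    if "0 < m" for m
  proof -
    have "\<exists>z. real m < z \<and> z < real (Suc m) \<and>
        real (Suc m) powr (1 - s) - real m powr (1 - s)
          = (real (Suc m) - real m) * ((1 - s) * z powr (- s))"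
    proof (rule MVT2)
      fix x assume "real m \<le> x" "x \<le> real (Suc m)"
      with that have "x > 0" by auto
      show "((\<lambda>x. x powr (1 - s)) has_real_derivative (1 - s) * x powr - s) (at x)"
        using DERIV_powr[OF DERIV_ident \<open>x > 0\<close> DERIV_const[of "1 - s"]] \<open>x > 0\<close>
        by (auto elim!: DERIV_cong simp: powr_diff powr_minus field_simps)
    qed simp
    then obtain z where z: "real m < z" "z < real (Suc m)"
      "real (Suc m) powr (1 - s) - real m powr (1 - s) = (1 - s) * z powr (- s)" by auto
    have "real (Suc m) powr (- s) \<le> z powr (- s)"
      using z assms that by (intro powr_mono2') auto
    moreover have "z powr (- s) = (real m powr (1 - s) - real (Suc m) powr (1 - s)) / (s - 1)"
      using z(3) assms by (simp add: field_simps)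
    ultimately show ?thesis by simp
  qed
  have "(\<Sum>m\<in>{n<..M}. real m powr (- s)) \<le> (real n powr (1 - s) - real M powr (1 - s)) / (s - 1)"
    if "n \<le> M"
    using that
  proof (induction M rule: dec_induct)
    case (step M)
    have "{n<..Suc M} = insert (Suc M) {n<..M}" using step.hyps by auto
    then show ?case using step telescope[of M] assms by (simp add: diff_divide_distrib)
  qed simp
  moreover have "(real n powr (1 - s) - real M powr (1 - s)) / (s - 1) \<le> real n powr (1 - s) / (s - 1)"
    using assms by (intro divide_right_mono) auto
  ultimately show ?thesis using assms by (cases "n \<le> M") auto
qed

section \<open>Entire solutions of the Jacobi equation\<close>

fun jacobi_forward ::
  "(nat \<Rightarrow> real) \<Rightarrow> (nat \<Rightarrow> real) \<Rightarrow> complex \<Rightarrow> complex \<Rightarrow> complex \<Rightarrow> nat \<Rightarrow> complex" where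
  "jacobi_forward a b z x y 0 = x"
| "jacobi_forward a b z x y (Suc 0) = y"
| "jacobi_forward a b z x y (Suc (Suc n)) =
     ((z - of_real (b (Suc n))) * jacobi_forward a b z x y (Suc n)
       - of_real (a n) * jacobi_forward a b z x y n) / of_real (a (Suc n))"

text \<open>Isolates the equation at index 0, the only one that involves the convention 1/2 and the
  index -1; all others live on natural indices.\<close>

lemma jacobi_solution_iff:
  "jacobi_solution a b z u \<longleftrightarrow>
     1 / 2 * u (- 1) + of_real (b 0) * u 0 + of_real (a 0) * u 1 = z * u 0 \<and>
     (\<forall>n. of_real (a n) * u (int n) + of_real (b (Suc n)) * u (int (Suc n))
        + of_real (a (Suc n)) * u (int (Suc (Suc n))) = z * u (int (Suc n)))"
proof -
  have all_nat: "(\<forall>n. P n) \<longleftrightarrow> P 0 \<and> (\<forall>n. P (Suc n))" for P :: "nat \<Rightarrow> bool"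
    by (metis not0_implies_Suc)
  show ?thesis
    unfolding jacobi_solution_def jacobi_offdiag_def
    by (subst all_nat) (simp add: nat_add_distrib algebra_simps)
qed

lemma jacobi_solution_Suc:
  assumes "jacobi_solution a b z u"
  shows "of_real (a n) * u (int n) + of_real (b (Suc n)) * u (int (Suc n))
        + of_real (a (Suc n)) * u (int (Suc (Suc n))) = z * u (int (Suc n))"
  using assms unfolding jacobi_solution_iff by blast

text \<open>Since no \<open>a n\<close> vanishes, the equation can be solved backwards: data at
  \<open>Suc N\<close> and \<open>Suc (Suc N)\<close> force the value at \<open>N\<close>, which
  reduces everything to data at 0 and 1. The data are arbitrary functions of z.\<close>

lemma jacobi_solution_exists:
  assumes a: "\<And>n. a n > 0"
  shows "\<exists>f. (\<forall>z. jacobi_solution a b z (\<lambda>k. f k z)) \<and> f (int N) = x \<and> f (int (Suc N)) = y"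
proof (induction N arbitrary: x y)
  case 0
  \<comment> \<open>The factor 2 inverts the coefficient 1/2 at index -1; indices below -1 repeat
    the same value as junk.\<close>
  define f where "f k z = (if k < 0 then 2 * ((z - of_real (b 0)) * x z - of_real (a 0) * y z)
    else jacobi_forward a b z (x z) (y z) (nat k))" for k :: int and z
  have "jacobi_solution a b z (\<lambda>k. f k z)" for z
    unfolding jacobi_solution_iff
  proof (intro conjI allI)
    show "1 / 2 * f (- 1) z + of_real (b 0) * f 0 z + of_real (a 0) * f 1 z = z * f 0 z"
      by (simp add: f_def algebra_simps)
    show "of_real (a n) * f (int n) z + of_real (b (Suc n)) * f (int (Suc n)) z
        + of_real (a (Suc n)) * f (int (Suc (Suc n))) z = z * f (int (Suc n)) z" for n
      using a[of "Suc n"] by (simp add: f_def field_simps del: of_nat_Suc)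
  qed
  moreover have "f (int 0) = x" "f (int (Suc 0)) = y" by (auto simp: f_def)
  ultimately show ?case by blast
next
  case (Suc N)
  \<comment> \<open>The value at \<open>N\<close> that the equation at index \<open>Suc N\<close>
    forces.\<close>
  define w where "w z = ((z - of_real (b (Suc N))) * x z - of_real (a (Suc N)) * y z) / of_real (a N)" for z
  obtain f where f: "\<And>z. jacobi_solution a b z (\<lambda>k. f k z)" "f (int N) = w" "f (int (Suc N)) = x"
    using Suc.IH[of w x] by blast
  have w: "of_real (a N) * w z = (z - of_real (b (Suc N))) * x z - of_real (a (Suc N)) * y z" for z
    using a[of N] by (simp add: w_def)
  have "of_real (a (Suc N)) * f (int (Suc (Suc N))) z = of_real (a (Suc N)) * y z" for z
  proof -
    have "of_real (a (Suc N)) * f (int (Suc (Suc N))) z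
        = z * x z - (of_real (a N) * w z + of_real (b (Suc N)) * x z)"
      using jacobi_solution_Suc[OF f(1)[of z], of N] unfolding f(2,3) by (metis add_diff_cancel_left')
    then show ?thesis unfolding w by (simp add: algebra_simps del: of_nat_Suc)
  qed
  then have "f (int (Suc (Suc N))) z = y z" for z
    using a[of "Suc N"] by simp
  then show ?case using f by blast
qed

text \<open>Positivity of \<open>a\<close> allows stepping up and down, each value being a
  combination of the two adjacent ones and of z times the nearer one. Holomorphy and exponential
  type both propagate this way.\<close>

lemma jacobi_solution_closure:
  assumes a: "\<And>n. a n > 0"
    and f: "\<And>z. jacobi_solution a b z (\<lambda>k. f k z)"
    and lin: "\<And>F G c d. P F \<Longrightarrow> P G \<Longrightarrow> P (\<lambda>z. c * F z + d * G z)"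
    and mult: "\<And>F. P F \<Longrightarrow> P (\<lambda>z. z * F z)"
    and N: "P (f (int N))" "P (f (int (Suc N)))"
  shows "P (f (int n))"
proof -
  have up: "P (f (int (Suc (Suc n))))" if "P (f (int n))" "P (f (int (Suc n)))" for n
  proof -
    have "f (int (Suc (Suc n))) = (\<lambda>z. (1 / of_real (a (Suc n))) * (z * f (int (Suc n)) z) +
        1 * (- of_real (b (Suc n) / a (Suc n)) * f (int (Suc n)) z + - of_real (a n / a (Suc n)) * f (int n) z))"
      using jacobi_solution_Suc[OF f, of n] a[of "Suc n"] by (auto simp: field_simps simp del: of_nat_Suc)
    then show ?thesis using lin[OF mult[OF that(2)] lin[OF that(2,1)]] by metis
  qed
  have down: "P (f (int n))" if "P (f (int (Suc (Suc n))))" "P (f (int (Suc n)))" for n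
  proof -
    have "f (int n) = (\<lambda>z. (1 / of_real (a n)) * (z * f (int (Suc n)) z) +
        1 * (- of_real (b (Suc n) / a n) * f (int (Suc n)) z
           + - of_real (a (Suc n) / a n) * f (int (Suc (Suc n))) z))"
      using jacobi_solution_Suc[OF f, of n] a[of n] by (auto simp: field_simps simp del: of_nat_Suc)
    then show ?thesis using lin[OF mult[OF that(2)] lin[OF that(2,1)]] by metis
  qed
  have "P (f (int n)) \<and> P (f (int (Suc n)))" if "N \<le> n"
    using that by (induction n rule: dec_induct) (use N up in auto)
  moreover have "P (f (int n)) \<and> P (f (int (Suc n)))" if "n \<le> N"
    using that by (induction n rule: inc_induct) (use N down in auto)
  ultimately show ?thesis using nat_le_linear by blast
qed

text \<open>The forward step is continuous in the two preceding values, so a limit needs to be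
  extracted only at \<open>N\<close> and \<open>Suc N\<close>.\<close>

lemma jacobi_solution_tendsto:
  assumes a: "\<And>n. a n > 0"
    and v: "\<And>j. jacobi_solution a b z (v j)" and u: "jacobi_solution a b z u"
    and N: "(\<lambda>j. v j (int N)) \<longlonglongrightarrow> u (int N)" "(\<lambda>j. v j (int (Suc N))) \<longlonglongrightarrow> u (int (Suc N))"
    and "N \<le> n"
  shows "(\<lambda>j. v j (int n)) \<longlonglongrightarrow> u (int n)"
proof -
  have next_val: "w (int (Suc (Suc n))) =
      ((z - of_real (b (Suc n))) * w (int (Suc n)) - of_real (a n) * w (int n)) / of_real (a (Suc n))"
    if "jacobi_solution a b z w" for w n
    using jacobi_solution_Suc[OF that, of n] a[of "Suc n"] by (auto simp: field_simps simp del: of_nat_Suc)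
  have "(\<lambda>j. v j (int n)) \<longlonglongrightarrow> u (int n) \<and> (\<lambda>j. v j (int (Suc n))) \<longlonglongrightarrow> u (int (Suc n))"
    using \<open>N \<le> n\<close>
  proof (induction n rule: dec_induct)
    case (step n)
    moreover have "complex_of_real (a (Suc n)) \<noteq> 0" using a[of "Suc n"] by simp
    ultimately show ?case
      unfolding next_val[OF v] next_val[OF u] by (auto intro!: tendsto_intros simp del: of_nat_Suc)
  qed (use N in auto)
  then show ?thesis ..
qed

text \<open>Solutions equal to \<open>g\<close> at \<open>M\<close> and \<open>Suc M\<close> obey a
  bound independent of \<open>M\<close>, so they form normal families at \<open>N\<close> and
  \<open>Suc N\<close>. The limits at these two indices determine an entire solution, and the bound
  passes to it.\<close>

lemma jacobi_limit_solution:
  fixes g :: "nat \<Rightarrow> complex" and B :: "nat \<Rightarrow> real \<Rightarrow> real"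
  assumes a: "\<And>n. a n > 0"
    and bound: "\<And>z M v n. jacobi_solution a b z v \<Longrightarrow> v (int M) = g M \<Longrightarrow> v (int (Suc M)) = g (Suc M)
        \<Longrightarrow> N \<le> n \<Longrightarrow> n \<le> M \<Longrightarrow> norm (v (int n) - g n) \<le> B n (norm z)"
    and B: "\<And>n. mono (B n)"
  shows "\<exists>f. (\<forall>z. jacobi_solution a b z (\<lambda>k. f k z)) \<and> (\<forall>n. f (int n) holomorphic_on UNIV) \<and>
    (\<forall>n\<ge>N. \<forall>z. norm (f (int n) z - g n) \<le> B n (norm z))"
proof -
  have "\<exists>f. (\<forall>z. jacobi_solution a b z (\<lambda>k. f k z)) \<and> f (int M) = (\<lambda>_. g M)
      \<and> f (int (Suc M)) = (\<lambda>_. g (Suc M))" for M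
    by (rule jacobi_solution_exists[OF a])
  then obtain F where F: "\<And>M z. jacobi_solution a b z (\<lambda>k. F M k z)" "\<And>M. F M (int M) = (\<lambda>_. g M)"
      "\<And>M. F M (int (Suc M)) = (\<lambda>_. g (Suc M))"
    by metis
  have hol: "F M (int n) holomorphic_on UNIV" for M n
    by (rule jacobi_solution_closure[OF a F(1), where N = M])
       (auto simp: F(2,3) simp del: of_nat_Suc intro!: holomorphic_intros)
  have F_bound: "norm (F M (int n) z - g n) \<le> B n (norm z)" if "N \<le> n" "n \<le> M" for M n z
    by (rule bound[where v = "\<lambda>k. F M k z" and M = M]) (use F that in \<open>auto simp del: of_nat_Suc\<close>)
  \<comment> \<open>The free index sequence \<open>q\<close> lets a second extraction run along the
    subsequence found by the first.\<close>
  have montel: "\<exists>h r. h holomorphic_on UNIV \<and> strict_mono r \<and>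
      (\<forall>z. (\<lambda>j. F (q (r j)) (int n) z) \<longlonglongrightarrow> h z)"
    if "N \<le> n" "\<And>j. n \<le> q j" for n and q :: "nat \<Rightarrow> nat"
  proof (rule Montel[of UNIV "range (\<lambda>j. F (q j) (int n))" "\<lambda>j. F (q j) (int n)"])
    show "h holomorphic_on UNIV" if "h \<in> range (\<lambda>j. F (q j) (int n))" for h
      using that hol by auto
    show "\<exists>C. \<forall>h\<in>range (\<lambda>j. F (q j) (int n)). \<forall>z\<in>K. norm (h z) \<le> C" if K: "compact K" for K
    proof -
      obtain R where R: "\<And>z. z \<in> K \<Longrightarrow> norm z \<le> R"
        using compact_imp_bounded[OF K] by (auto simp: bounded_iff)
      \<comment> \<open>Monotonicity of \<open>B n\<close> turns the bound into a uniform one on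
        \<open>K\<close>.\<close>
      have "norm (F (q j) (int n) z) \<le> B n R + norm (g n)" if "z \<in> K" for j z
        using F_bound[OF \<open>N \<le> n\<close> \<open>n \<le> q j\<close>, of z] monoD[OF B R[OF that], of n]
          norm_triangle_sub[of "F (q j) (int n) z" "g n"] by simp
      then show ?thesis by blast
    qed
    show ?thesis if "h holomorphic_on UNIV" "strict_mono r"
      "\<And>z. z \<in> UNIV \<Longrightarrow> (\<lambda>j. F (q (r j)) (int n) z) \<longlonglongrightarrow> h z" for h and r :: "nat \<Rightarrow> nat"
      using that by blast
  qed auto
  \<comment> \<open>The offset \<open>N + 1\<close> keeps every truncation index at least
    \<open>Suc N\<close>, so the bound is available at both \<open>N\<close> and
    \<open>Suc N\<close>.\<close>
  obtain x r where x: "x holomorphic_on UNIV" "strict_mono r"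
      "\<And>z. (\<lambda>j. F (N + 1 + r j) (int N) z) \<longlonglongrightarrow> x z"
    using montel[of N "\<lambda>j. N + 1 + j"] by auto
  obtain y r' where y: "y holomorphic_on UNIV" "strict_mono r'"
      "\<And>z. (\<lambda>j. F (N + 1 + r (r' j)) (int (Suc N)) z) \<longlonglongrightarrow> y z"
    using montel[of "Suc N" "\<lambda>j. N + 1 + r j"] by auto
  have x': "(\<lambda>j. F (N + 1 + r (r' j)) (int N) z) \<longlonglongrightarrow> x z" for z
    using LIMSEQ_subseq_LIMSEQ[OF x(3) y(2), of z] by (simp add: o_def)
  obtain f where f: "\<And>z. jacobi_solution a b z (\<lambda>k. f k z)" "f (int N) = x" "f (int (Suc N)) = y"
    using jacobi_solution_exists[where a = a and b = b and N = N and x = x and y = y, OF a] by blast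
  have "f (int n) holomorphic_on UNIV" for n
    by (rule jacobi_solution_closure[OF a f(1), where N = N])
       (auto simp: f(2,3) x(1) y(1) simp del: of_nat_Suc intro!: holomorphic_intros)
  moreover have "norm (f (int n) z - g n) \<le> B n (norm z)" if "N \<le> n" for n z
  proof (rule tendsto_upperbound)
    have "(\<lambda>j. F (N + 1 + r (r' j)) (int n) z) \<longlonglongrightarrow> f (int n) z"
      by (rule jacobi_solution_tendsto[OF a, where v = "\<lambda>j k. F (N + 1 + r (r' j)) k z" and u = "\<lambda>k. f k z",
            OF F(1) f(1)]) (use f(2,3) x' y(3) that in auto)
    then show "(\<lambda>j. norm (F (N + 1 + r (r' j)) (int n) z - g n)) \<longlonglongrightarrow> norm (f (int n) z - g n)"
      by (intro tendsto_intros)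
    \<comment> \<open>Indices of a subsequence dominate their positions, so for fixed
      \<open>n\<close> the bound holds for all late \<open>j\<close>.\<close>
    have "n \<le> N + 1 + r (r' j)" if "n \<le> j" for j
      using seq_suble[OF x(2), of "r' j"] seq_suble[OF y(2), of j] that by linarith
    then show "\<forall>\<^sub>F j in sequentially. norm (F (N + 1 + r (r' j)) (int n) z - g n) \<le> B n (norm z)"
      using F_bound[OF that] unfolding eventually_sequentially by blast
  qed simp
  ultimately show ?thesis using f(1) by blast
qed

section \<open>Exponential type of solutions\<close>

definition exp_type_le :: "real \<Rightarrow> (complex \<Rightarrow> complex) \<Rightarrow> bool" where
  "exp_type_le \<epsilon> F \<longleftrightarrow> (\<forall>\<delta>>\<epsilon>. \<exists>C. \<forall>z. norm (F z) \<le> C * exp (\<delta> * norm z))"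

lemma exp_type_le_lincomb:
  assumes "exp_type_le \<epsilon> F" "exp_type_le \<epsilon> G"
  shows "exp_type_le \<epsilon> (\<lambda>z. c * F z + d * G z)"
  unfolding exp_type_le_def
proof (intro allI impI)
  fix \<delta> :: real assume "\<epsilon> < \<delta>"
  then obtain C D where "\<And>z. norm (F z) \<le> C * exp (\<delta> * norm z)" "\<And>z. norm (G z) \<le> D * exp (\<delta> * norm z)"
    using assms unfolding exp_type_le_def by metis
  then have "norm (c * F z + d * G z) \<le> norm c * (C * exp (\<delta> * norm z)) + norm d * (D * exp (\<delta> * norm z))" for z
    by (intro norm_triangle_le add_mono) (auto simp: norm_mult intro!: mult_left_mono)
  then have "norm (c * F z + d * G z) \<le> (norm c * C + norm d * D) * exp (\<delta> * norm z)" for z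
    by (simp add: algebra_simps)
  then show "\<exists>C. \<forall>z. norm (c * F z + d * G z) \<le> C * exp (\<delta> * norm z)" by blast
qed

text \<open>The strict slack \<epsilon> < \<delta> built into \<open>exp_type_le\<close> makes this
  possible: half of it absorbs the factor z through
  \<open>norm z \<le> exp (\<eta> * norm z) / \<eta>\<close>.\<close>

lemma exp_type_le_mult_id:
  assumes "exp_type_le \<epsilon> F"
  shows "exp_type_le \<epsilon> (\<lambda>z. z * F z)"
  unfolding exp_type_le_def
proof (intro allI impI)
  fix \<delta> :: real assume "\<epsilon> < \<delta>"
  define \<eta> where "\<eta> = (\<delta> - \<epsilon>) / 2"
  have "\<eta> > 0" "\<delta> - \<eta> > \<epsilon>" using \<open>\<epsilon> < \<delta>\<close> by (auto simp: \<eta>_def field_simps)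
  obtain C where C: "\<And>z. norm (F z) \<le> C * exp ((\<delta> - \<eta>) * norm z)"
    using assms \<open>\<delta> - \<eta> > \<epsilon>\<close> unfolding exp_type_le_def by blast
  have "norm (z * F z) \<le> C / \<eta> * exp (\<delta> * norm z)" for z
  proof -
    have "norm z \<le> exp (\<eta> * norm z) / \<eta>"
      using exp_ge_add_one_self[of "\<eta> * norm z"] \<open>\<eta> > 0\<close> by (simp add: field_simps del: exp_ge_add_one_self)
    then have "norm (z * F z) \<le> exp (\<eta> * norm z) / \<eta> * (C * exp ((\<delta> - \<eta>) * norm z))"
      unfolding norm_mult using C \<open>\<eta> > 0\<close> by (intro mult_mono) auto
    also have "\<dots> = C / \<eta> * exp (\<delta> * norm z)"
      by (simp add: algebra_simps flip: exp_add)
    finally show ?thesis .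
  qed
  then show "\<exists>C. \<forall>z. norm (z * F z) \<le> C * exp (\<delta> * norm z)" by blast
qed

text \<open>Every \<open>f\<^sub>n\<close> is a combination of \<open>f\<^sub>m\<close> and \<open>f\<^sub>m\<^sub>+\<^sub>1\<close> with polynomial coefficients, so its type
  is bounded by theirs for arbitrarily large \<open>m\<close>.\<close>

lemma jacobi_solution_minimal_type:
  assumes a: "\<And>n. a n > 0"
    and f: "\<And>z. jacobi_solution a b z (\<lambda>k. f k z)"
    and bound: "\<And>n z. N \<le> n \<Longrightarrow> norm (f (int n) z) \<le> D n * exp (\<kappa> n * norm z)"
    and \<kappa>: "\<kappa> \<longlonglongrightarrow> 0"
  shows "minimal_exponential_type (f (int n))"
  unfolding minimal_exponential_type_def
proof (intro allI impI)
  fix \<epsilon> :: real assume "\<epsilon> > 0"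
  \<comment> \<open>Half of \<epsilon> is used because \<open>exp_type_le\<close> yields bounds only
    at strictly larger exponents, finally at \<epsilon> itself.\<close>
  have "\<forall>\<^sub>F m in sequentially. \<kappa> m < \<epsilon> / 2" 
    using order_tendstoD(2)[OF \<kappa>, of "\<epsilon> / 2"] \<open>\<epsilon> > 0\<close> by simp
  then obtain m0 where m0: "\<And>m. m \<ge> m0 \<Longrightarrow> \<kappa> m < \<epsilon> / 2" unfolding eventually_sequentially by blast
  have type: "exp_type_le (\<epsilon> / 2) (f (int m))" if "m \<ge> m0" "m \<ge> N" for m
    unfolding exp_type_le_def
  proof (intro allI impI)
    fix \<delta> :: real assume "\<epsilon> / 2 < \<delta>"
    have "norm (f (int m) z) \<le> \<bar>D m\<bar> * exp (\<delta> * norm z)" for z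
      using bound[OF that(2), of z] m0[OF that(1)] \<open>\<epsilon> / 2 < \<delta>\<close>
      by (elim order_trans) (intro mult_mono, auto intro!: mult_right_mono)
    then show "\<exists>C. \<forall>z. norm (f (int m) z) \<le> C * exp (\<delta> * norm z)" by blast
  qed
  have "exp_type_le (\<epsilon> / 2) (f (int n))"
    by (rule jacobi_solution_closure[OF a f, where N = "max m0 N"])
       (auto intro: exp_type_le_lincomb exp_type_le_mult_id intro!: type simp del: of_nat_Suc)
  then show "\<exists>C. \<forall>z. norm (f (int n) z) \<le> C * exp (\<epsilon> * norm z)"
    using \<open>\<epsilon> > 0\<close> unfolding exp_type_le_def by simp
qed

section \<open>Expansions in powers of \<open>n\<^sup>-\<^sup>1\<^sup>/\<^sup>2\<close>\<close>

abbreviation rsqrt :: "nat \<Rightarrow> complex" where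
  "rsqrt n \<equiv> of_real (1 / sqrt (real n))"

text \<open>Modulo the error of order \<open>N\<close>, a polynomial in n^(-1/2) acts as a truncated
  power series, so cancellations become comparisons of coefficients.\<close>

definition expands :: "nat \<Rightarrow> (nat \<Rightarrow> complex) \<Rightarrow> complex poly \<Rightarrow> bool" where
  "expands N f P \<longleftrightarrow> (\<lambda>n. f n - poly P (rsqrt n)) \<in> O(\<lambda>n. rsqrt n ^ N)"

lemma rsqrt_power_bigo:
  assumes "M \<le> N"
  shows "(\<lambda>n. rsqrt n ^ N) \<in> O(\<lambda>n. rsqrt n ^ M)"
proof -
  have "norm (rsqrt n ^ N) \<le> norm (rsqrt n ^ M)" for n
    unfolding norm_power using assms
    by (cases "n = 0") (auto intro!: power_decreasing simp: power_0_left norm_divide)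
  then show ?thesis by (intro bigoI[of _ 1]) auto
qed

lemma poly_rsqrt_bounded: "(\<lambda>n. poly P (rsqrt n)) \<in> O(\<lambda>_. 1)"
proof (induction P)
  case (pCons c P)
  have "rsqrt \<in> O(\<lambda>_. 1)" using rsqrt_power_bigo[of 0 1] by simp
  then have "(\<lambda>n. rsqrt n * poly P (rsqrt n)) \<in> O(\<lambda>_. 1 * 1)"
    using pCons.IH by (rule landau_o.big.mult)
  then show ?case by (auto intro!: sum_in_bigo)
qed simp

lemma expands_const: "expands N (\<lambda>_. c) [:c:]"
  by (simp add: expands_def)

lemma expands_add:
  assumes "expands N f P" "expands N g Q"
  shows "expands N (\<lambda>n. f n + g n) (P + Q)"
  using sum_in_bigo(1)[OF assms[unfolded expands_def]] by (simp add: expands_def algebra_simps)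

lemma expands_bounded:
  assumes "expands N f P"
  shows "f \<in> O(\<lambda>_. 1)"
proof -
  have "(\<lambda>n. f n - poly P (rsqrt n)) \<in> O(\<lambda>_. 1)"
    using assms rsqrt_power_bigo[of 0 N] unfolding expands_def by (auto intro: landau_o.big_trans)
  from sum_in_bigo(1)[OF this poly_rsqrt_bounded[of P]] show ?thesis by simp
qed

lemma expands_mult:
  assumes f: "expands N f P" and g: "expands N g Q"
  shows "expands N (\<lambda>n. f n * g n) (P * Q)"
proof -
  have "(\<lambda>n. (f n - poly P (rsqrt n)) * g n) \<in> O(\<lambda>n. rsqrt n ^ N * 1)"
    using f expands_bounded[OF g] unfolding expands_def by (rule landau_o.big.mult)
  moreover have "(\<lambda>n. poly P (rsqrt n) * (g n - poly Q (rsqrt n))) \<in> O(\<lambda>n. 1 * rsqrt n ^ N)"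
    using poly_rsqrt_bounded g unfolding expands_def by (rule landau_o.big.mult)
  ultimately show ?thesis
    using sum_in_bigo(1) unfolding expands_def by (fastforce simp: algebra_simps)
qed

lemma expands_smult: "expands N f P \<Longrightarrow> expands N (\<lambda>n. c * f n) (smult c P)"
  using expands_mult[OF expands_const[of N c], of f P] by simp

text \<open>Coefficients of degree \<open>N\<close> and above disappear in the error, since
  \<open>P - Q\<close> is divisible by the \<open>N\<close>-th power of the variable.\<close>

lemma expands_change_poly:
  assumes f: "expands N f P" and eq: "\<And>i. i < N \<Longrightarrow> coeff P i = coeff Q i"
  shows "expands N f Q"
proof -
  have "monom 1 N dvd P - Q" using eq by (simp add: monom_1_dvd_iff')
  then obtain R where R: "P - Q = monom 1 N * R" by (elim dvdE)
  have "(\<lambda>n. rsqrt n ^ N * poly R (rsqrt n)) \<in> O(\<lambda>n. rsqrt n ^ N * 1)"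
    by (intro landau_o.big.mult landau_o.big_refl poly_rsqrt_bounded)
  also have "(\<lambda>n. rsqrt n ^ N * poly R (rsqrt n)) = (\<lambda>n. poly P (rsqrt n) - poly Q (rsqrt n))"
    by (simp add: R[symmetric] poly_monom flip: poly_diff) (simp add: R poly_monom)
  finally show ?thesis using f sum_in_bigo(1) unfolding expands_def by fastforce
qed

lemma expands_cong:
  assumes "expands N f P" "\<forall>\<^sub>F n in sequentially. f n = g n"
  shows "expands N g P"
proof -
  have "\<forall>\<^sub>F n in sequentially. f n - poly P (rsqrt n) = g n - poly P (rsqrt n)"
    using assms(2) by eventually_elim simp
  from landau_o.big.in_cong[OF this] show ?thesis using assms(1) unfolding expands_def by blast
qed

text \<open>Without a constant term in \<open>P\<close>, \<open>w\<close> is of order n^(-1/2), so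
  the Taylor remainder after the cubic term is O(n^(-2)), enough for
  \<open>N \<le> 4\<close>.\<close>

lemma expands_exp:
  assumes w: "expands N w P" and N: "0 < N" "N \<le> 4" and P: "coeff P 0 = 0"
  shows "expands N (\<lambda>n. exp (w n)) ([:1:] + P + smult (1 / 2) (P ^ 2) + smult (1 / 6) (P ^ 3))"
proof -
  have pw: "expands N (\<lambda>n. w n ^ 2) (P ^ 2)" "expands N (\<lambda>n. w n ^ 3) (P ^ 3)"
    using expands_mult[OF w w] expands_mult[OF w expands_mult[OF w w]]
    by (auto simp: power2_eq_square power3_eq_cube mult.assoc)
  have "w \<in> O(\<lambda>n. rsqrt n ^ 1)"
  proof -
    have "(\<lambda>n. w n - poly P (rsqrt n)) \<in> O(\<lambda>n. rsqrt n ^ 1)"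
      using w rsqrt_power_bigo[of 1 N] N unfolding expands_def by (auto intro: landau_o.big_trans)
    then have "expands 1 w P" by (simp add: expands_def)
    then have "expands 1 w 0" by (rule expands_change_poly) (use P in auto)
    then show ?thesis by (simp add: expands_def)
  qed
  then have "(\<lambda>n. w n ^ 4) \<in> O(\<lambda>n. (rsqrt n ^ 1) ^ 4)" by (rule landau_o.big_power)
  then have w4: "(\<lambda>n. w n ^ 4) \<in> O(\<lambda>n. rsqrt n ^ N)"
    using rsqrt_power_bigo[of N 4] N by (auto intro: landau_o.big_trans)
  obtain B where B: "\<forall>\<^sub>F n in sequentially. norm (w n) \<le> B"
    using expands_bounded[OF w] by (auto elim!: landau_o.bigE)
  have "(\<lambda>n. exp (w n) - (1 + w n + w n ^ 2 / 2 + w n ^ 3 / 6)) \<in> O(\<lambda>n. w n ^ 4)"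
  proof (rule bigoI)
    show "\<forall>\<^sub>F n in sequentially. norm (exp (w n) - (1 + w n + w n ^ 2 / 2 + w n ^ 3 / 6))
        \<le> exp B / 6 * norm (w n ^ 4)"
      using B
    proof eventually_elim
      case (elim n)
      have "norm (exp (w n) - (\<Sum>i\<le>3. w n ^ i / fact i)) \<le> exp \<bar>Re (w n)\<bar> * norm (w n) ^ Suc 3 / fact 3"
        by (rule Taylor_exp)
      also have "\<dots> \<le> exp B * norm (w n) ^ Suc 3 / fact 3"
        using elim abs_Re_le_cmod[of "w n"] by (intro divide_right_mono mult_right_mono) auto
      finally show ?case
        by (simp add: norm_power norm_mult numeral_eq_Suc fact_numeral field_simps)
    qed
  qed
  then have "(\<lambda>n. exp (w n) - (1 + w n + w n ^ 2 / 2 + w n ^ 3 / 6)) \<in> O(\<lambda>n. rsqrt n ^ N)"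
    using w4 by (rule landau_o.big_trans)
  then have rem: "expands N (\<lambda>n. exp (w n) - (1 + w n + 1 / 2 * w n ^ 2 + 1 / 6 * w n ^ 3)) 0"
    unfolding expands_def by simp
  from expands_add[OF rem expands_add[OF expands_add[OF expands_add[OF expands_const[of N 1] w]
      expands_smult[OF pw(1), of "1 / 2"]] expands_smult[OF pw(2), of "1 / 6"]]]
  show ?thesis by (simp only: diff_add_cancel add_0)
qed

lemma expands_sqrt_mult:
  assumes "expands (Suc N) f (pCons 0 P)"
  shows "expands N (\<lambda>n. of_real (sqrt (real n)) * f n) P"
proof -
  have big: "(\<lambda>n. of_real (sqrt (real n)) * (f n - poly (pCons 0 P) (rsqrt n)))
      \<in> O(\<lambda>n. of_real (sqrt (real n)) * rsqrt n ^ Suc N)"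
    using assms unfolding expands_def by (intro landau_o.big.mult landau_o.big_refl)
  have eq1: "\<forall>\<^sub>F n in sequentially. of_real (sqrt (real n)) * (f n - poly (pCons 0 P) (rsqrt n))
        = of_real (sqrt (real n)) * f n - poly P (rsqrt n)"
    using eventually_gt_at_top[of 0] by eventually_elim (simp add: field_simps)
  have eq2: "\<forall>\<^sub>F n in sequentially. of_real (sqrt (real n)) * rsqrt n ^ Suc N = rsqrt n ^ N"
    using eventually_gt_at_top[of 0] by eventually_elim (simp add: field_simps)
  show ?thesis
    using big unfolding expands_def landau_o.big.in_cong[OF eq1] landau_o.big.cong[OF eq2] .
qed

text \<open>One step changes n^(-1/2) by O(n^(-3/2)); the product rule along the Horner form extends
  this to polynomials.\<close>

lemma poly_rsqrt_diff_bigo: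
  "(\<lambda>n. poly P (rsqrt (Suc n)) - poly P (rsqrt n)) \<in> O(\<lambda>n. rsqrt n ^ 3)"
proof (induction P)
  case (pCons c P)
  have "(\<lambda>n. 1 / sqrt (real (Suc n)) - 1 / sqrt (real n)) \<in> O(\<lambda>n. (1 / sqrt (real n)) ^ 3)"
    by real_asymp
  then have "(\<lambda>n. complex_of_real (1 / sqrt (real (Suc n)) - 1 / sqrt (real n)))
      \<in> O(\<lambda>n. of_real ((1 / sqrt (real n)) ^ 3))"
    by (subst landau_o.big.of_real_iff)
  then have d: "(\<lambda>n. rsqrt (Suc n) - rsqrt n) \<in> O(\<lambda>n. rsqrt n ^ 3)"
    by simp
  have "(\<lambda>n. poly P (rsqrt (Suc n))) \<in> O(\<lambda>_. 1)"
    using poly_rsqrt_bounded[of P] by (auto dest: landau_o.big.compose[OF _ filterlim_Suc])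
  with d have "(\<lambda>n. (rsqrt (Suc n) - rsqrt n) * poly P (rsqrt (Suc n))) \<in> O(\<lambda>n. rsqrt n ^ 3 * 1)"
    by (rule landau_o.big.mult)
  moreover have "(\<lambda>n. rsqrt n * (poly P (rsqrt (Suc n)) - poly P (rsqrt n))) \<in> O(\<lambda>n. 1 * rsqrt n ^ 3)"
    using rsqrt_power_bigo[of 0 1] pCons.IH by (intro landau_o.big.mult) auto
  ultimately show ?case using sum_in_bigo(1) by (fastforce simp: algebra_simps)
qed simp

text \<open>An error of order 3 already matches the increments of the polynomial part, so it is
  estimated without cancellation. The order n^(-3/2) is summable, which gives bounded
  variation.\<close>

lemma expands_diff_bigo:
  assumes "expands 3 v P"
  shows "(\<lambda>n. v (Suc n) - v n) \<in> O(\<lambda>n. rsqrt n ^ 3)"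
proof -
  have "(\<lambda>n. 1 / sqrt (real (Suc n))) \<in> O(\<lambda>n. 1 / sqrt (real n))" by real_asymp
  then have "(\<lambda>n. rsqrt (Suc n)) \<in> O(rsqrt)"
    by (subst landau_o.big.of_real_iff)
  then have "(\<lambda>n. rsqrt (Suc n) ^ 3) \<in> O(\<lambda>n. rsqrt n ^ 3)" by (rule landau_o.big_power)
  moreover have "(\<lambda>n. v (Suc n) - poly P (rsqrt (Suc n))) \<in> O(\<lambda>n. rsqrt (Suc n) ^ 3)"
    using assms landau_o.big.compose[OF _ filterlim_Suc] unfolding expands_def by fastforce
  ultimately have "(\<lambda>n. v (Suc n) - poly P (rsqrt (Suc n))) \<in> O(\<lambda>n. rsqrt n ^ 3)"
    using landau_o.big_trans by blast
  then have "(\<lambda>n. (v (Suc n) - poly P (rsqrt (Suc n))) + (poly P (rsqrt (Suc n)) - poly P (rsqrt n))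
      - (v n - poly P (rsqrt n))) \<in> O(\<lambda>n. rsqrt n ^ 3)"
    by (rule sum_in_bigo(2)[OF sum_in_bigo(1)[OF _ poly_rsqrt_diff_bigo] assms[unfolded expands_def]])
  then show ?thesis by simp
qed

lemma expands_tendsto:
  assumes "expands N f P" "0 < N"
  shows "f \<longlonglongrightarrow> coeff P 0"
proof -
  have h: "rsqrt \<longlonglongrightarrow> 0"
  proof -
    have "(\<lambda>n. 1 / sqrt (real n)) \<longlonglongrightarrow> 0" by real_asymp
    from tendsto_of_real[OF this, where 'a = complex] show ?thesis by simp
  qed
  have "(\<lambda>n. rsqrt n ^ N) \<longlonglongrightarrow> 0 ^ N" by (intro tendsto_power h)
  then have "(\<lambda>n. rsqrt n ^ N) \<in> o(\<lambda>_. 1)"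
    using assms(2) by (intro smalloI_tendsto) (auto simp: power_0_left)
  with assms(1) have "(\<lambda>n. f n - poly P (rsqrt n)) \<in> o(\<lambda>_. 1)"
    unfolding expands_def by (rule landau_o.big_small_trans)
  then have "(\<lambda>n. f n - poly P (rsqrt n)) \<longlonglongrightarrow> 0"
    by (auto dest: smalloD_tendsto)
  moreover have "(\<lambda>n. poly P (rsqrt n)) \<longlonglongrightarrow> poly P 0" by (intro tendsto_poly h)
  ultimately have "(\<lambda>n. (f n - poly P (rsqrt n)) + poly P (rsqrt n)) \<longlonglongrightarrow> 0 + poly P 0"
    by (rule tendsto_add)
  then show ?thesis by (simp add: poly_0_coeff_0)
qed

section \<open>Expansions of the coefficients and of the ansatz quotients\<close>

lemma expands_of_real:
  assumes "(\<lambda>n. f n - poly p (1 / sqrt (real n))) \<in> O(\<lambda>n. (1 / sqrt (real n)) ^ N)"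
  shows "expands N (\<lambda>n. of_real (f n)) (map_poly of_real p)"
proof -
  have "poly (map_poly of_real p) (of_real x) = (of_real (poly p x) :: complex)" for x
    by (induction p) (auto simp: map_poly_pCons)
  moreover have "(\<lambda>n. complex_of_real (f n - poly p (1 / sqrt (real n))))
      \<in> O(\<lambda>n. of_real ((1 / sqrt (real n)) ^ N))"
    using assms by (subst landau_o.big.of_real_iff)
  ultimately show ?thesis
    unfolding expands_def by (simp only: of_real_diff of_real_power)
qed

text \<open>In the shifted law, (1 - 1/n)^\<sigma> contributes the extra -\<sigma>/n, while
  replacing \<alpha>/(n - 1) by \<alpha>/n costs only O(n^(-2)).\<close>

lemma power_law_expands:
  fixes a :: "nat \<Rightarrow> real"
  assumes "\<exists>r. r \<in> O(\<lambda>n. real n powr (- 2)) \<and>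
      (\<forall>\<^sub>F n in sequentially. a n = real n powr \<sigma> * (1 + \<alpha> * real n powr (- 1) + r n))"
  shows "expands 4 (\<lambda>n. of_real (a n / real n powr \<sigma>)) [:1, 0, of_real \<alpha>:]"
    and "expands 4 (\<lambda>n. of_real (a (n - 1) / real n powr \<sigma>)) [:1, 0, of_real (\<alpha> - \<sigma>):]"
proof -
  obtain r where r: "r \<in> O(\<lambda>n. real n powr (- 2))"
    and a: "\<forall>\<^sub>F n in sequentially. a n = real n powr \<sigma> * (1 + \<alpha> * real n powr (- 1) + r n)"
    using assms by blast
  have h4: "(\<lambda>n. real n powr (- 2)) \<in> O(\<lambda>n. (1 / sqrt (real n)) ^ 4)" by real_asymp
  have "(\<lambda>n. a n / real n powr \<sigma> - poly [:1, 0, \<alpha>:] (1 / sqrt (real n))) \<in> O(\<lambda>n. (1 / sqrt (real n)) ^ 4)"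
  proof -
    have "\<forall>\<^sub>F n in sequentially. r n = a n / real n powr \<sigma> - poly [:1, 0, \<alpha>:] (1 / sqrt (real n))"
      using a eventually_gt_at_top[of 0]
      by eventually_elim (simp add: powr_minus field_simps)
    from landau_o.big.in_cong[OF this] show ?thesis using landau_o.big_trans[OF r h4] by blast
  qed
  from expands_of_real[OF this] show "expands 4 (\<lambda>n. of_real (a n / real n powr \<sigma>)) [:1, 0, of_real \<alpha>:]"
    by (simp add: map_poly_pCons)
  have "(\<lambda>n. a (n - 1) / real n powr \<sigma> - poly [:1, 0, \<alpha> - \<sigma>:] (1 / sqrt (real n)))
      \<in> O(\<lambda>n. (1 / sqrt (real n)) ^ 4)"
  proof -
    \<comment> \<open>The explicit part of the shifted law minus its polynomial, accessible to
      \<open>real_asymp\<close>; the abstract remainder \<open>r\<close> is estimated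
      separately.\<close>
    define m where "m n = (1 - 1 / real n) powr \<sigma> * (1 + \<alpha> / (real n - 1)) - (1 + (\<alpha> - \<sigma>) / real n)" for n :: nat
    have pred: "filterlim (\<lambda>n::nat. n - 1) at_top at_top"
      by (rule filterlim_minus_const_nat_at_top)
    have ev: "\<forall>\<^sub>F n in sequentially. m n + (1 - 1 / real n) powr \<sigma> * r (n - 1)
        = a (n - 1) / real n powr \<sigma> - poly [:1, 0, \<alpha> - \<sigma>:] (1 / sqrt (real n))"
      using eventually_compose_filterlim[OF a pred] eventually_gt_at_top[of 1]
    proof eventually_elim
      case (elim n)
      then have "(1 - 1 / real n) powr \<sigma> = (real n - 1) powr \<sigma> / real n powr \<sigma>"
        by (subst powr_divide[symmetric]) (auto simp: field_simps)
      moreover have "a (n - 1) = (real n - 1) powr \<sigma> * (1 + \<alpha> / (real n - 1) + r (n - 1))"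
        using elim by (simp add: powr_minus field_simps of_nat_diff)
      ultimately show ?case
        using elim by (simp add: m_def algebra_simps add_divide_distrib)
    qed
    have "m \<in> O(\<lambda>n. (1 / sqrt (real n)) ^ 4)" unfolding m_def by real_asymp
    moreover have "(\<lambda>n. (1 - 1 / real n) powr \<sigma> * r (n - 1)) \<in> O(\<lambda>n. 1 * (1 / sqrt (real n)) ^ 4)"
    proof (rule landau_o.big.mult)
      show "(\<lambda>n. (1 - 1 / real n) powr \<sigma>) \<in> O(\<lambda>_. 1)" by real_asymp
      have "(\<lambda>n. r (n - 1)) \<in> O(\<lambda>n. real (n - 1) powr (- 2))"
        by (rule landau_o.big.compose[OF r pred])
      also have "(\<lambda>n. real (n - 1) powr (- 2)) \<in> O(\<lambda>n. (1 / sqrt (real n)) ^ 4)"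
      proof -
        have "\<forall>\<^sub>F n in sequentially. (real n - 1) powr (- 2) = real (n - 1) powr (- 2)"
          using eventually_gt_at_top[of 0] by eventually_elim (simp add: of_nat_diff)
        from landau_o.big.in_cong[OF this]
        have "(\<lambda>n. real (n - 1) powr (- 2)) \<in> O(\<lambda>n. (1 / sqrt (real n)) ^ 4) \<longleftrightarrow>
            (\<lambda>n. (real n - 1) powr (- 2)) \<in> O(\<lambda>n. (1 / sqrt (real n)) ^ 4)" by (rule sym)
        also have "\<dots>" by real_asymp
        finally show ?thesis .
      qed
      finally show "(\<lambda>n. r (n - 1)) \<in> O(\<lambda>n. (1 / sqrt (real n)) ^ 4)" .
    qed
    ultimately have "(\<lambda>n. m n + (1 - 1 / real n) powr \<sigma> * r (n - 1)) \<in> O(\<lambda>n. (1 / sqrt (real n)) ^ 4)"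
      by (intro sum_in_bigo) auto
    then show ?thesis unfolding landau_o.big.in_cong[OF ev] .
  qed
  from expands_of_real[OF this]
  show "expands 4 (\<lambda>n. of_real (a (n - 1) / real n powr \<sigma>)) [:1, 0, of_real (\<alpha> - \<sigma>):]"
    by (simp add: map_poly_pCons)
qed

lemma powr_expands:
  "expands 4 (\<lambda>n. of_real ((1 + 1 / real n) powr p)) [:1, 0, of_real p:]"
  "expands 4 (\<lambda>n. of_real ((1 - 1 / real n) powr p)) [:1, 0, - of_real p:]"
proof -
  have "(\<lambda>n. (1 + 1 / real n) powr p - poly [:1, 0, p:] (1 / sqrt (real n))) \<in> O(\<lambda>n. (1 / sqrt (real n)) ^ 4)"
    by (simp, real_asymp)
  from expands_of_real[OF this] show "expands 4 (\<lambda>n. of_real ((1 + 1 / real n) powr p)) [:1, 0, of_real p:]"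
    by (simp add: map_poly_pCons)
  have "(\<lambda>n. (1 - 1 / real n) powr p - poly [:1, 0, - p:] (1 / sqrt (real n))) \<in> O(\<lambda>n. (1 / sqrt (real n)) ^ 4)"
    by (simp, real_asymp)
  from expands_of_real[OF this] show "expands 4 (\<lambda>n. of_real ((1 - 1 / real n) powr p)) [:1, 0, - of_real p:]"
    by (simp add: map_poly_pCons)
qed

text \<open>With h = n^(-1/2), the differences of square roots are h/2 - h^3/8 and h/2 + h^3/8 up to
  O(h^4). They differ only in the cubic coefficient \<open>q\<close>, so \<open>exp_odd\<close>
  serves both.\<close>

lemma exp_sqrt_diff_expands:
  "expands 4 (\<lambda>n. exp (c * of_real (sqrt (real (Suc n)) - sqrt (real n))))
     [:1, c / 2, c ^ 2 / 8, c ^ 3 / 48 - c / 8:]"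
  "expands 4 (\<lambda>n. exp (c * of_real (sqrt (real n) - sqrt (real n - 1))))
     [:1, c / 2, c ^ 2 / 8, c ^ 3 / 48 + c / 8:]"
proof -
  have exp_odd: "expands 4 (\<lambda>n. exp (c * w n)) [:1, c / 2, c ^ 2 / 8, c ^ 3 / 48 + c * q:]"
    if "expands 4 w [:0, 1 / 2, 0, q:]" for w q
  proof (rule expands_change_poly[OF expands_exp[OF expands_smult[OF that]]])
    fix i :: nat assume "i < 4"
    then have "i = 0 \<or> i = 1 \<or> i = 2 \<or> i = 3" by auto
    then show "coeff ([:1:] + smult c [:0, 1 / 2, 0, q:] + smult (1 / 2) (smult c [:0, 1 / 2, 0, q:] ^ 2)
        + smult (1 / 6) (smult c [:0, 1 / 2, 0, q:] ^ 3)) i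
      = coeff [:1, c / 2, c ^ 2 / 8, c ^ 3 / 48 + c * q:] i"
      by (elim disjE) (simp_all add: power2_eq_square power3_eq_cube numeral_2_eq_2 numeral_3_eq_3 field_simps)
  qed auto
  have "(\<lambda>n. sqrt (real (Suc n)) - sqrt (real n) - poly [:0, 1 / 2, 0, - 1 / 8:] (1 / sqrt (real n)))
      \<in> O(\<lambda>n. (1 / sqrt (real n)) ^ 4)" by (simp, real_asymp)
  from exp_odd[of _ "- 1 / 8"] expands_of_real[OF this]
  show "expands 4 (\<lambda>n. exp (c * of_real (sqrt (real (Suc n)) - sqrt (real n))))
     [:1, c / 2, c ^ 2 / 8, c ^ 3 / 48 - c / 8:]"
    by (simp add: map_poly_pCons)
  have "(\<lambda>n. sqrt (real n) - sqrt (real n - 1) - poly [:0, 1 / 2, 0, 1 / 8:] (1 / sqrt (real n)))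
      \<in> O(\<lambda>n. (1 / sqrt (real n)) ^ 4)" by (simp, real_asymp)
  from exp_odd[of _ "1 / 8"] expands_of_real[OF this]
  show "expands 4 (\<lambda>n. exp (c * of_real (sqrt (real n) - sqrt (real n - 1))))
     [:1, c / 2, c ^ 2 / 8, c ^ 3 / 48 + c / 8:]"
    by (simp add: map_poly_pCons)
qed

definition ansatz :: "real \<Rightarrow> complex \<Rightarrow> nat \<Rightarrow> complex" where
  "ansatz p s n = of_real (real n powr p) * exp (- 2 * s * of_real (sqrt (real n)))"

lemma ansatz_nonzero: "0 < n \<Longrightarrow> ansatz p s n \<noteq> 0"
  by (simp add: ansatz_def)

lemma ansatz_Suc:
  assumes "0 < n"
  shows "ansatz p s (Suc n) = ansatz p s n *
    (of_real ((1 + 1 / real n) powr p) * exp (- 2 * s * of_real (sqrt (real (Suc n)) - sqrt (real n))))"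
proof -
  have "(1 + 1 / real n) powr p = real (Suc n) powr p / real n powr p"
    using assms by (subst powr_divide[symmetric]) (auto simp: field_simps)
  moreover have "exp (- 2 * s * of_real (sqrt (real (Suc n)))) = exp (- 2 * s * of_real (sqrt (real n)))
      * exp (- 2 * s * of_real (sqrt (real (Suc n)) - sqrt (real n)))"
    by (simp add: algebra_simps flip: exp_add)
  ultimately show ?thesis
    using assms unfolding ansatz_def by simp
qed

lemma ansatz_pred:
  assumes "1 < n"
  shows "ansatz p s (n - 1) = ansatz p s n *
    (of_real ((1 - 1 / real n) powr p) * exp (2 * s * of_real (sqrt (real n) - sqrt (real n - 1))))"
proof -
  have "(1 - 1 / real n) powr p = real (n - 1) powr p / real n powr p"
    using assms by (subst powr_divide[symmetric]) (auto simp: field_simps of_nat_diff)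
  moreover have "exp (- 2 * s * of_real (sqrt (real (n - 1)))) = exp (- 2 * s * of_real (sqrt (real n)))
      * exp (2 * s * of_real (sqrt (real n) - sqrt (real n - 1)))"
    using assms by (simp add: algebra_simps of_nat_diff flip: exp_add)
  ultimately show ?thesis
    using assms unfolding ansatz_def by simp
qed

section \<open>The residual of the ansatz\<close>

text \<open>For n > 1, \<open>ratio_up\<close> and \<open>ratio_down\<close> are the quotients of
  the ansatz at \<open>Suc n\<close> and \<open>n - 1\<close> by its value at \<open>n\<close>, in
  explicit form.\<close>

definition ratio_up :: "real \<Rightarrow> complex \<Rightarrow> nat \<Rightarrow> complex" where
  "ratio_up p s n = of_real ((1 + 1 / real n) powr p) *
     exp (- 2 * s * of_real (sqrt (real (Suc n)) - sqrt (real n)))"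

definition ratio_down :: "real \<Rightarrow> complex \<Rightarrow> nat \<Rightarrow> complex" where
  "ratio_down p s n = of_real ((1 - 1 / real n) powr p) *
     exp (2 * s * of_real (sqrt (real n) - sqrt (real n - 1)))"

text \<open>The orders 0 and 1 in n^(-1/2) cancel between the two neighbours. Order 2 vanishes
  exactly because \<open>s ^ 2\<close> is \<tau>, and order 3, which is s (1/2 - 2 p - \<sigma>),
  because of the choice of \<open>p\<close>. Here \<open>b\<close> stands for the normalised
  diagonal with leading term n^\<sigma>.\<close>

lemma residual_bigo:
  fixes a b :: "nat \<Rightarrow> real"
  assumes a: "\<exists>r. r \<in> O(\<lambda>n. real n powr (- 2)) \<and>
      (\<forall>\<^sub>F n in sequentially. a n = real n powr \<sigma> * (1 + \<alpha> * real n powr (- 1) + r n))"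
    and b: "\<exists>r. r \<in> O(\<lambda>n. real n powr (- 2)) \<and>
      (\<forall>\<^sub>F n in sequentially. b n = real n powr \<sigma> * (1 + \<beta> * real n powr (- 1) + r n))"
    and p: "p = 1 / 4 - \<sigma> / 2" and s: "s ^ 2 = of_real (2 * \<beta> - 2 * \<alpha> + \<sigma>)"
  shows "(\<lambda>n. of_real (a n / real n powr \<sigma>) * ratio_up p s n
      + of_real (a (n - 1) / real n powr \<sigma>) * ratio_down p s n
      - 2 * of_real (b n / real n powr \<sigma>)) \<in> O(\<lambda>n. rsqrt n ^ 4)"
proof -
  have up: "expands 4 (ratio_up p s) ([:1, 0, of_real p:] * [:1, - s, s ^ 2 / 2, s / 4 - s ^ 3 / 6:])"
    using expands_mult[OF powr_expands(1)[of p] exp_sqrt_diff_expands(1)[of "- 2 * s"]]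
    unfolding ratio_up_def by (simp add: power2_eq_square power3_eq_cube mult.assoc)
  have down: "expands 4 (ratio_down p s) ([:1, 0, - of_real p:] * [:1, s, s ^ 2 / 2, s / 4 + s ^ 3 / 6:])"
    using expands_mult[OF powr_expands(2)[of p] exp_sqrt_diff_expands(2)[of "2 * s"]]
    unfolding ratio_down_def by (simp add: power2_eq_square power3_eq_cube mult.assoc add.commute)
  let ?P = "[:1, 0, of_real \<alpha>:] * ([:1, 0, of_real p:] * [:1, - s, s ^ 2 / 2, s / 4 - s ^ 3 / 6:])
      + ([:1, 0, of_real (\<alpha> - \<sigma>):] * ([:1, 0, - of_real p:] * [:1, s, s ^ 2 / 2, s / 4 + s ^ 3 / 6:])
        + smult (- 2) [:1, 0, of_real \<beta>:])"
  have "expands 4 (\<lambda>n. of_real (a n / real n powr \<sigma>) * ratio_up p s n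
      + (of_real (a (n - 1) / real n powr \<sigma>) * ratio_down p s n
      + - 2 * of_real (b n / real n powr \<sigma>))) ?P"
    by (intro expands_add expands_mult[OF _ up] expands_mult[OF _ down] expands_smult
        power_law_expands[OF a] power_law_expands[OF b])
  moreover have "coeff ?P i = coeff 0 i" if "i < 4" for i
  proof -
    have i: "i = 0 \<or> i = 1 \<or> i = 2 \<or> i = 3" using that by auto
    have \<beta>: "complex_of_real \<beta> = (s * s + 2 * of_real \<alpha> - of_real \<sigma>) / 2"
      using s by (simp add: power2_eq_square field_simps)
    from i show ?thesis
      by (elim disjE) (simp_all add: p \<beta> numeral_2_eq_2 numeral_3_eq_3 power2_eq_square power3_eq_cube field_simps)
  qed
  ultimately have "expands 4 (\<lambda>n. of_real (a n / real n powr \<sigma>) * ratio_up p s n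
      + (of_real (a (n - 1) / real n powr \<sigma>) * ratio_down p s n
      + - 2 * of_real (b n / real n powr \<sigma>))) 0"
    by (rule expands_change_poly)
  then show ?thesis by (simp add: expands_def algebra_simps)
qed

section \<open>Flux and growth: the size of the Volterra kernel\<close>

definition flux :: "(nat \<Rightarrow> real) \<Rightarrow> real \<Rightarrow> complex \<Rightarrow> nat \<Rightarrow> complex" where
  "flux a p s n = of_real (a n) * ansatz p s n * ansatz p s (Suc n)"

text \<open>Up to the factor 2 s, a discrete antiderivative of 1 / \<open>flux\<close>, which
  behaves like n^(-1/2) exp(4 s sqrt n).\<close>

definition growth :: "complex \<Rightarrow> nat \<Rightarrow> complex" where
  "growth s n = exp (4 * s * of_real (sqrt (real n)))"

text \<open>\<open>1 / flux\<close> is the increment of \<open>growth\<close> divided by \<open>flux_growth\<close>; since the latter tends to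
  \<open>2 s \<noteq> 0\<close> with bounded variation, summation by parts bounds the kernel by \<open>growth\<close> without any
  logarithmic loss in the oscillating case \<open>\<tau> < 0\<close>.\<close>

definition flux_growth :: "(nat \<Rightarrow> real) \<Rightarrow> real \<Rightarrow> complex \<Rightarrow> nat \<Rightarrow> complex" where
  "flux_growth a p s n = flux a p s n * (growth s (Suc n) - growth s n)"

text \<open>The exponentials cancel: the kernel grows like \<open>growth\<close> and the potential
  carries the squared ansatz, so only a power of n remains in their product.\<close>

lemma ansatz_square_growth: "ansatz p s n ^ 2 * growth s n = of_real (real n powr (2 * p))"
proof -
  have "exp (- (4 * s * of_real (sqrt (real n)))) = exp (- (2 * s * of_real (sqrt (real n)))) ^ 2"
    by (simp add: mult.assoc flip: exp_of_nat_mult)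
  moreover have "real n powr (2 * p) = (real n powr p) ^ 2"
    by (simp add: power2_eq_square flip: powr_add)
  moreover have "exp (- (4 * s * of_real (sqrt (real n)))) * growth s n = 1"
    by (simp add: growth_def flip: exp_add)
  ultimately show ?thesis
    unfolding ansatz_def by (simp add: power_mult_distrib mult.assoc)
qed

text \<open>With x the increment of sqrt n, \<open>flux_growth\<close> equals sqrt n times 2 sinh(2
  s x) times factors tending to 1; as x is about 1/(2 sqrt n), the limit is 2 s.\<close>

lemma flux_growth_expands:
  assumes a: "\<exists>r. r \<in> O(\<lambda>n. real n powr (- 2)) \<and>
      (\<forall>\<^sub>F n in sequentially. a n = real n powr \<sigma> * (1 + \<alpha> * real n powr (- 1) + r n))"
    and p: "p = 1 / 4 - \<sigma> / 2"
  obtains P where "expands 3 (flux_growth a p s) P" "coeff P 0 = 2 * s"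
proof -
  let ?x = "\<lambda>n. complex_of_real (sqrt (real (Suc n)) - sqrt (real n))"
  have "expands 4 (\<lambda>n. exp (2 * s * ?x n) + - 1 * exp (- 2 * s * ?x n))
      (pCons 0 [:2 * s, 0, s ^ 3 / 3 - s / 2:])"
    by (rule expands_change_poly[OF expands_add[OF exp_sqrt_diff_expands(1)
          expands_smult[OF exp_sqrt_diff_expands(1)]]])
       (simp add: power2_eq_square power3_eq_cube mult.assoc)
  \<comment> \<open>The factor sqrt n costs one order, from 4 to 3, and moves the linear coefficient
    2 s to the constant place.\<close>
  then have sinh: "expands 3 (\<lambda>n. of_real (sqrt (real n)) * (exp (2 * s * ?x n) + - 1 * exp (- 2 * s * ?x n)))
      [:2 * s, 0, s ^ 3 / 3 - s / 2:]"
    by (intro expands_sqrt_mult) simp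
  have mono: "expands 3 f Q" if "expands 4 f Q" for f Q
    using that rsqrt_power_bigo[of 3 4] unfolding expands_def by (auto intro: landau_o.big_trans)
  let ?P = "[:1, 0, of_real \<alpha>:] * ([:1, 0, of_real p:] * [:2 * s, 0, s ^ 3 / 3 - s / 2:])"
  have "expands 3 (\<lambda>n. of_real (a n / real n powr \<sigma>) * (of_real ((1 + 1 / real n) powr p) *
      (of_real (sqrt (real n)) * (exp (2 * s * ?x n) + - 1 * exp (- 2 * s * ?x n))))) ?P"
    by (intro expands_mult sinh mono[OF power_law_expands(1)[OF a]] mono[OF powr_expands(1)])
  moreover have "\<forall>\<^sub>F n in sequentially. of_real (a n / real n powr \<sigma>) * (of_real ((1 + 1 / real n) powr p) *
      (of_real (sqrt (real n)) * (exp (2 * s * ?x n) + - 1 * exp (- 2 * s * ?x n)))) = flux_growth a p s n"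
    using eventually_gt_at_top[of 0]
  proof eventually_elim
    case (elim n)
    have gr: "growth s (Suc n) = growth s n * exp (2 * s * ?x n) ^ 2"
      by (simp add: growth_def algebra_simps flip: exp_add exp_of_nat_mult)
    have inv: "exp (- 2 * s * ?x n) * exp (2 * s * ?x n) = 1"
      by (simp flip: exp_add)
    have "flux_growth a p s n = of_real (a n) * (ansatz p s n ^ 2 * growth s n) * of_real ((1 + 1 / real n) powr p)
        * (exp (- 2 * s * ?x n) * (exp (2 * s * ?x n) ^ 2 - 1))"
      unfolding flux_growth_def flux_def ansatz_Suc[OF elim] gr
      by (simp add: power2_eq_square algebra_simps)
    also have "exp (- 2 * s * ?x n) * (exp (2 * s * ?x n) ^ 2 - 1) = exp (2 * s * ?x n) + - 1 * exp (- 2 * s * ?x n)"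
      using inv by (simp add: right_diff_distrib power2_eq_square flip: mult.assoc)
    also have "ansatz p s n ^ 2 * growth s n = of_real (sqrt (real n) / real n powr \<sigma>)"
      unfolding ansatz_square_growth using elim by (simp add: p powr_half_sqrt[symmetric] flip: powr_diff)
    finally show ?case by (simp add: mult_ac)
  qed
  ultimately have "expands 3 (flux_growth a p s) ?P" by (rule expands_cong)
  then show ?thesis by (rule that) simp
qed

section \<open>Solutions close to the ansatz\<close>

text \<open>What matters is that \<open>N\<close> and \<open>C\<close> depend neither on z nor on
  \<open>M\<close>, so the bound survives \<open>M\<close> tending to infinity. Passing to
  \<open>- \<nu> * b n / 2\<close> gives both coefficient sequences the leading term
  n^\<sigma>.\<close>

lemma truncated_solution_bound:
  fixes a b :: "nat \<Rightarrow> real"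
  assumes a_pos: "\<And>n. a n > 0"
    and a_asymp: "\<exists>r. r \<in> O(\<lambda>n. real n powr (- 2)) \<and>
      (\<forall>\<^sub>F n in sequentially. a n = real n powr \<sigma> * (1 + \<alpha> * real n powr (- 1) + r n))"
    and b_asymp: "\<exists>r. r \<in> O(\<lambda>n. real n powr (- 2)) \<and>
      (\<forall>\<^sub>F n in sequentially. - \<nu> * b n / 2 = real n powr \<sigma> * (1 + \<beta> * real n powr (- 1) + r n))"
    and \<sigma>: "\<sigma> > 3 / 2" and \<nu>: "\<nu> ^ 2 = 1" and p: "p = 1 / 4 - \<sigma> / 2"
    and s: "s ^ 2 = of_real (2 * \<beta> - 2 * \<alpha> + \<sigma>)" "s \<noteq> 0" "0 \<le> Re s"
  defines "g \<equiv> \<lambda>n. of_real (\<nu> ^ n) * ansatz p s n"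
  obtains N C where "1 < N" "0 \<le> C"
    "\<And>z M v n. jacobi_solution a b z v \<Longrightarrow> v (int M) = g M \<Longrightarrow> v (int (Suc M)) = g (Suc M) \<Longrightarrow>
      N \<le> n \<Longrightarrow> n \<le> M \<Longrightarrow> norm (v (int n) - g n) \<le>
        norm (g n) * (exp (C * (norm z * real n powr (3 / 2 - \<sigma>) + real n powr (- 1 / 2))) - 1)"
proof -
  let ?v = "flux_growth a p s"
  define R where "R n = of_real (a n / real n powr \<sigma>) * ratio_up p s n
      + of_real (a (n - 1) / real n powr \<sigma>) * ratio_down p s n
      - 2 * of_real (- \<nu> * b n / 2 / real n powr \<sigma>)" for n
  obtain C1 where C1: "0 < C1" "\<forall>\<^sub>F n in sequentially. norm (R n) \<le> C1 * norm (rsqrt n ^ 4)"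
    using residual_bigo[OF a_asymp b_asymp p s(1)] unfolding R_def by (elim landau_o.bigE)
  obtain P where P: "expands 3 ?v P" "coeff P 0 = 2 * s"
    using flux_growth_expands[OF a_asymp p] .
  obtain C2 where C2: "0 < C2" "\<forall>\<^sub>F n in sequentially. norm (?v (Suc n) - ?v n) \<le> C2 * norm (rsqrt n ^ 3)"
    using expands_diff_bigo[OF P(1)] by (elim landau_o.bigE)
  have "(\<lambda>n. norm (?v n)) \<longlonglongrightarrow> norm (2 * s)"
    using tendsto_norm[OF expands_tendsto[OF P(1)]] P(2) by simp
  \<comment> \<open>Half of the limit 2 |s| serves as lower bound, keeping the reciprocals below 1 /
    |s|.\<close>
  then have "\<forall>\<^sub>F n in sequentially. norm s < norm (?v n)"
    using s(2) by (intro order_tendstoD(1)) (auto simp: norm_mult)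
  from this C1(2) C2(2) have "\<forall>\<^sub>F n in sequentially. norm s < norm (?v n) \<and>
      norm (R n) \<le> C1 * norm (rsqrt n ^ 4) \<and> norm (?v (Suc n) - ?v n) \<le> C2 * norm (rsqrt n ^ 3)"
    by eventually_elim auto
  then obtain N0 where N0: "\<And>n. n \<ge> N0 \<Longrightarrow> norm s < norm (?v n)"
      "\<And>n. n \<ge> N0 \<Longrightarrow> norm (R n) \<le> C1 * norm (rsqrt n ^ 4)"
      "\<And>n. n \<ge> N0 \<Longrightarrow> norm (?v (Suc n) - ?v n) \<le> C2 * norm (rsqrt n ^ 3)"
    unfolding eventually_sequentially by blast
  \<comment> \<open>Starting at 2 ensures \<open>n - 1 \<ge> 1\<close>, as the tail sum below and
    the quotient formulas require.\<close>
  define N where "N = max 2 N0"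
  have N: "1 < N" "N0 \<le> N" by (auto simp: N_def)
  have rsqrt4: "norm (rsqrt n ^ 4) = real n powr (- 2)" if "0 < n" for n
  proof -
    have "sqrt (real n) ^ 4 = (sqrt (real n) ^ 2) ^ 2" by (simp only: flip: power_mult) simp
    then show ?thesis using that by (simp add: norm_power norm_divide power_divide powr_minus powr_numeral field_simps)
  qed
  have rsqrt3: "norm (rsqrt n ^ 3) = real n powr (- 3 / 2)" if "0 < n" for n
    using that by (simp add: norm_power norm_divide power_divide powr_minus powr_half_sqrt[symmetric]
        powr_powr field_simps flip: powr_realpow)
  \<comment> \<open>\<open>V\<close> bounds the variation of the reciprocals: increments
    \<open>C2 / norm s ^ 2 * k powr (- 3 / 2)\<close>, with 2 bounding the sum of the powers.
    \<open>T\<close> is then the constant of \<open>norm_sum_by_parts_le\<close>.\<close>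
  define V where "V = C2 / norm s ^ 2 * 2"
  define T where "T = 2 * (1 / norm s) + V"
  have T_nonneg: "0 \<le> T" using C2(1) by (simp add: T_def V_def)
  have t_diff: "norm (1 / ?v (Suc k) - 1 / ?v k) \<le> C2 / norm s ^ 2 * real k powr (- 3 / 2)" if "N \<le> k" for k
  proof -
    have v: "norm s < norm (?v k)" "norm s < norm (?v (Suc k))"
      using N0(1)[of k] N0(1)[of "Suc k"] that N by auto
    then have nz: "?v k \<noteq> 0" "?v (Suc k) \<noteq> 0" by auto
    have "norm (1 / ?v (Suc k) - 1 / ?v k) = norm (?v (Suc k) - ?v k) / (norm (?v (Suc k)) * norm (?v k))"
      using nz by (simp add: divide_simps norm_divide norm_mult norm_minus_commute)
    also have "\<dots> \<le> C2 * real k powr (- 3 / 2) / (norm s * norm s)"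
      using N0(3)[of k] rsqrt3[of k] that N v s(2) C2(1)
      by (intro frac_le mult_mono mult_pos_pos) auto
    finally show ?thesis by (simp add: power2_eq_square)
  qed
  have kernel: "norm (\<Sum>k\<in>{n..<m}. 1 / flux a p s k) \<le> T * norm (growth s m)" if "N \<le> n" "n \<le> m" for n m
  proof -
    have "1 / flux a p s k = 1 / ?v k * (growth s (Suc k) - growth s k)" if "N \<le> k" for k
    proof -
      have "?v k \<noteq> 0" using N0(1)[of k] that N by auto
      then show ?thesis by (simp add: flux_growth_def)
    qed
    then have "(\<Sum>k\<in>{n..<m}. 1 / flux a p s k) = (\<Sum>k\<in>{n..<m}. 1 / ?v k * (growth s (Suc k) - growth s k))"
      using that by (intro sum.cong) auto
    also have "norm \<dots> \<le> (2 * (1 / norm s) + V) * norm (growth s m)"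
    proof (rule norm_sum_by_parts_le[OF that(2)])
      \<comment> \<open>The modulus of \<open>growth\<close> is nondecreasing because
        \<open>0 \<le> Re s\<close>.\<close>
      show "norm (growth s k) \<le> norm (growth s m)" if "k \<le> m" for k
        using that s(3) by (auto simp: growth_def intro!: mult_left_mono)
      show "norm (1 / ?v k) \<le> 1 / norm s" if "n \<le> k" for k
        using N0(1)[of k] that \<open>N \<le> n\<close> N s(2) by (simp add: norm_divide frac_le)
      have "(\<Sum>k\<in>{n..<m}. norm (1 / ?v (Suc k) - 1 / ?v k))
          \<le> (\<Sum>k\<in>{n..<m}. C2 / norm s ^ 2 * real k powr (- 3 / 2))"
        using t_diff that by (intro sum_mono) auto
      \<comment> \<open>The tail estimate excludes its left endpoint, hence the start at
        \<open>n - 1\<close>.\<close>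
      also have "\<dots> \<le> C2 / norm s ^ 2 * (\<Sum>k\<in>{n - 1<..m}. real k powr (- 3 / 2))"
        unfolding sum_distrib_left[symmetric] using that N C2(1)
        by (intro mult_left_mono sum_mono2) auto
      also have "(\<Sum>k\<in>{n - 1<..m}. real k powr (- 3 / 2)) \<le> real (n - 1) powr (- 1 / 2) / (1 / 2)"
        using sum_powr_tail_le[of "3 / 2" "n - 1" m] that N by simp
      also have "\<dots> \<le> 2" using powr_mono[of "- 1 / 2" 0 "real (n - 1)"] that N by simp
      finally show "(\<Sum>k\<in>{n..<m}. norm (1 / ?v (Suc k) - 1 / ?v k)) \<le> V"
        using C2(1) by (simp add: V_def divide_right_mono)
    qed
    finally show ?thesis by (simp add: T_def)
  qed
  \<comment> \<open>The two summands come from the tails of m^(1/2 - \<sigma>) and m^(-3/2), at most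
    n^(3/2 - \<sigma>) / (\<sigma> - 3/2) and 2 n^(-1/2).\<close>
  define C where "C = T / (\<sigma> - 3 / 2) + 2 * (T * C1)"
  have "0 \<le> C" using T_nonneg C1(1) \<sigma> by (simp add: C_def)
  have bound: "norm (v (int n) - g n) \<le>
        norm (g n) * (exp (C * (norm z * real n powr (3 / 2 - \<sigma>) + real n powr (- 1 / 2))) - 1)"
    if v: "jacobi_solution a b z v" "v (int M) = g M" "v (int (Suc M)) = g (Suc M)"
      and n: "N \<le> n" "n \<le> M" for z M v n
  proof -
    define u where "u k = v (int k) / g k" for k
    \<comment> \<open>Chosen so that the equation for \<open>u\<close> is exactly in divergence
      form; the bracket is the squared ansatz times n^\<sigma> times the residual
      \<open>R\<close>.\<close>
    define q where "q k = of_real \<nu> * z * ansatz p s k ^ 2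
        - (flux a p s k + flux a p s (k - 1) + of_real (\<nu> * b k) * ansatz p s k ^ 2)" for k
    have \<nu>_pow: "(\<nu> ^ k) ^ 2 = 1" for k
      using \<nu> by (metis power_commutes power_mult power_one mult.commute)
    then have \<nu>_nz: "\<nu> ^ k \<noteq> 0" for k by (metis power_zero_numeral zero_neq_one)
    have g_nz: "g k \<noteq> 0" if "0 < k" for k
      using ansatz_nonzero[OF that] \<nu>_nz[of k] by (simp add: g_def)
    have v_eq: "v (int k) = of_real (\<nu> ^ k) * ansatz p s k * u k" if "0 < k" for k
      using g_nz[OF that] by (simp add: u_def) (simp add: g_def)
    have q: "q k = ansatz p s k ^ 2 * (of_real \<nu> * z - of_real (real k powr \<sigma>) * R k)" if "1 < k" for k
    proof -
      have up: "flux a p s k = of_real (a k) * ansatz p s k ^ 2 * ratio_up p s k"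
        using that by (simp add: flux_def ansatz_Suc ratio_up_def power2_eq_square)
      have down: "flux a p s (k - 1) = of_real (a (k - 1)) * ansatz p s k ^ 2 * ratio_down p s k"
        using that ansatz_pred[OF that, of p s] by (simp add: flux_def ratio_down_def power2_eq_square)
      show ?thesis
        unfolding q_def up down R_def using that by (simp add: field_simps)
    qed
    have rec: "flux a p s k * (u (Suc k) - u k) - flux a p s (k - 1) * (u k - u (k - 1)) = q k * u k"
      if "1 < k" for k
    proof -
      obtain j where j: "k = Suc j" "0 < j" using \<open>1 < k\<close> by (cases k) auto
      have "of_real (a j) * v (int j) + of_real (b k) * v (int k) + of_real (a k) * v (int (Suc k)) = z * v (int k)"
        using jacobi_solution_Suc[OF v(1), of j] j by simp
      \<comment> \<open>This multiplier symmetrises the equation: the off-diagonal terms become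
        fluxes and the signs collect into \<open>(\<nu> ^ j) ^ 2 = 1\<close>.\<close>
      then have "of_real (\<nu> ^ j) * ansatz p s k * (of_real (a j) * v (int j) + of_real (b k) * v (int k)
          + of_real (a k) * v (int (Suc k))) = of_real (\<nu> ^ j) * ansatz p s k * (z * v (int k))"
        by simp
      moreover have "v (int j) = of_real (\<nu> ^ j) * ansatz p s j * u j"
          "v (int k) = of_real (\<nu> * \<nu> ^ j) * ansatz p s k * u k"
          "v (int (Suc k)) = of_real (\<nu> ^ 2 * \<nu> ^ j) * ansatz p s (Suc k) * u (Suc k)"
        using v_eq[of j] v_eq[of k] v_eq[of "Suc k"] j by (auto simp: power2_eq_square)
      ultimately have "of_real ((\<nu> ^ j) ^ 2) * (flux a p s j * u j + of_real (\<nu> * b k) * ansatz p s k ^ 2 * u k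
          + of_real (\<nu> ^ 2) * flux a p s k * u (Suc k))
          = of_real ((\<nu> ^ j) ^ 2) * (of_real \<nu> * z * ansatz p s k ^ 2 * u k)"
        unfolding flux_def j(1) by (simp add: power2_eq_square algebra_simps del: of_nat_Suc)
      then have "flux a p s j * u j + of_real (\<nu> * b k) * ansatz p s k ^ 2 * u k
          + flux a p s k * u (Suc k) = of_real \<nu> * z * ansatz p s k ^ 2 * u k"
        unfolding \<nu>_pow \<nu> by simp
      then have "of_real \<nu> * z * ansatz p s k ^ 2 * u k = flux a p s j * u j
          + of_real (\<nu> * b k) * ansatz p s k ^ 2 * u k + flux a p s k * u (Suc k)" by simp
      then show ?thesis
        unfolding q_def j(1) diff_Suc_1 left_diff_distrib[of _ _ "u (Suc j)"]
        by (simp add: algebra_simps)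
    qed
    \<comment> \<open>Kernel bound \<open>T\<close> times m^(1/2 - \<sigma>) (|z| + C1 m^(\<sigma> -
      2)), the size of \<open>growth\<close> times \<open>q\<close>.\<close>
    define w where "w m = T * (norm z * real m powr (1 / 2 - \<sigma>) + C1 * real m powr (- 3 / 2))" for m
    have flux_nz: "flux a p s k \<noteq> 0" if "N \<le> k" for k
      using a_pos[of k] ansatz_nonzero[of k] ansatz_nonzero[of "Suc k"] that N by (auto simp: flux_def)
    have u_end: "u M = 1" "u (Suc M) = 1"
      using v(2,3) g_nz[of M] g_nz[of "Suc M"] n N by (auto simp: u_def simp del: of_nat_Suc)
    have qw: "norm ((\<Sum>k\<in>{n..<m}. 1 / flux a p s k) * q m) \<le> w m" if "N \<le> n" "n < m" for n m
    proof -
      have m: "1 < m" "N0 \<le> m" using that N by auto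
      have "norm (growth s m) * norm (ansatz p s m ^ 2) = real m powr (1 / 2 - \<sigma>)"
        using ansatz_square_growth[of p s m] by (simp add: p norm_mult[symmetric] mult.commute)
      moreover have "norm (of_real \<nu> * z - of_real (real m powr \<sigma>) * R m) \<le> norm z + C1 * real m powr (\<sigma> - 2)"
      proof -
        have "\<bar>\<nu>\<bar> = 1" using \<nu> by (auto simp: power2_eq_1_iff)
        moreover have "real m powr \<sigma> * norm (R m) \<le> real m powr \<sigma> * (C1 * real m powr (- 2))"
          using N0(2)[OF m(2)] rsqrt4[of m] m by (intro mult_left_mono) auto
        moreover have "real m powr \<sigma> * (C1 * real m powr (- 2)) = C1 * real m powr (\<sigma> - 2)"
          by (simp add: mult_ac flip: powr_add)
        ultimately show ?thesis
          using norm_triangle_ineq4[of "of_real \<nu> * z" "of_real (real m powr \<sigma>) * R m"]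
          by (simp add: norm_mult)
      qed
      ultimately have "norm (growth s m) * norm (q m) \<le>
          real m powr (1 / 2 - \<sigma>) * (norm z + C1 * real m powr (\<sigma> - 2))"
        unfolding q[OF m(1)] norm_mult[of "ansatz p s m ^ 2"] mult.assoc[symmetric]
        by (intro mult_mono) auto
      also have "\<dots> = norm z * real m powr (1 / 2 - \<sigma>) + C1 * real m powr (- 3 / 2)"
        by (simp add: algebra_simps flip: powr_add)
      finally have "T * (norm (growth s m) * norm (q m)) \<le> w m"
        unfolding w_def using T_nonneg by (rule mult_left_mono)
      moreover have "norm ((\<Sum>k\<in>{n..<m}. 1 / flux a p s k) * q m) \<le> T * norm (growth s m) * norm (q m)"
        unfolding norm_mult using kernel[of n m] that by (intro mult_right_mono) auto
      ultimately show ?thesis by simp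
    qed
    have "norm (u n - 1) \<le> exp (\<Sum>m\<in>{n<..M}. w m) - 1"
    proof (rule discrete_gronwall[OF _ _ n])
      show "u k = 1 + (\<Sum>m\<in>{k<..M}. ((\<Sum>i\<in>{k..<m}. 1 / flux a p s i) * q m) * u m)"
        if "N \<le> k" "k \<le> M" for k
        using N by (intro volterra_equation[OF _ u_end _ that] rec flux_nz) auto
    qed (use qw in auto)
    also have "\<dots> \<le> exp (C * (norm z * real n powr (3 / 2 - \<sigma>) + real n powr (- 1 / 2))) - 1"
    proof -
      have "(\<Sum>m\<in>{n<..M}. w m) = T * norm z * (\<Sum>m\<in>{n<..M}. real m powr (- (\<sigma> - 1 / 2)))
          + T * C1 * (\<Sum>m\<in>{n<..M}. real m powr (- (3 / 2)))"
        unfolding w_def by (simp add: sum.distrib sum_distrib_left algebra_simps)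
      also have "\<dots> \<le> T * norm z * (real n powr (1 - (\<sigma> - 1 / 2)) / (\<sigma> - 1 / 2 - 1))
          + T * C1 * (real n powr (1 - 3 / 2) / (3 / 2 - 1))"
        using T_nonneg C1(1) \<sigma> n N by (intro add_mono mult_left_mono sum_powr_tail_le) auto
      also have "\<dots> = T / (\<sigma> - 3 / 2) * (norm z * real n powr (3 / 2 - \<sigma>)) + 2 * (T * C1) * real n powr (- 1 / 2)"
        by (simp add: field_simps)
      also have "\<dots> \<le> C * (norm z * real n powr (3 / 2 - \<sigma>)) + C * real n powr (- 1 / 2)"
        using T_nonneg C1(1) \<sigma> by (intro add_mono mult_right_mono) (auto simp: C_def)
      finally show ?thesis by (simp add: algebra_simps)
    qed
    finally have "norm (u n - 1) \<le> \<dots>" .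
    moreover have "v (int n) - g n = g n * (u n - 1)"
      using g_nz[of n] n N by (simp add: u_def field_simps)
    ultimately show ?thesis by (simp add: norm_mult mult_left_mono)
  qed
  show ?thesis using that[OF N(1) \<open>0 \<le> C\<close>] bound by blast
qed


section \<open>From pointwise bounds to uniform asymptotics\<close>

lemma exp_minus_one_le: "exp x - 1 \<le> x * exp x" for x :: real
proof -
  have "1 - x \<le> exp (- x)" using exp_ge_add_one_self[of "- x"] by simp
  then have "(1 - x) * exp x \<le> exp (- x) * exp x" by (intro mult_right_mono) auto
  then show ?thesis by (simp add: algebra_simps flip: exp_add)
qed

text \<open>For |z| at most \<open>R\<close> both powers of n are bounded by n^(-\<rho>), by the
  choice of \<rho> as a minimum; the exponent is then at most
  \<open>L * n powr (- \<rho>) \<le> L\<close>, and \<open>exp x - 1 \<le> x * exp x\<close>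
  linearises it.\<close>

lemma asymp_unif_on_compactsI:
  fixes g :: "nat \<Rightarrow> complex"
  assumes \<rho>: "\<rho> = min (\<sigma> - 3 / 2) (1 / 2)" "0 \<le> \<rho>" and C: "0 \<le> C" and N: "0 < N"
    and g: "\<And>n. N \<le> n \<Longrightarrow> g n \<noteq> 0"
    and f: "\<And>n z. N \<le> n \<Longrightarrow> norm (f n z - g n) \<le>
        norm (g n) * (exp (C * (norm z * real n powr (3 / 2 - \<sigma>) + real n powr (- 1 / 2))) - 1)"
  shows "asymp_unif_on_compacts f g \<rho>"
  unfolding asymp_unif_on_compacts_def
proof (intro allI impI)
  fix K :: "complex set" assume "compact K"
  then obtain R where R: "0 < R" "\<And>z. z \<in> K \<Longrightarrow> norm z \<le> R"
    using compact_imp_bounded bounded_pos by metis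
  define r where "r n z = f n z / g n - 1" for n z
  define L where "L = C * (R + 1)"
  have "f n z = g n * (1 + r n z) \<and> norm (r n z) \<le> L * exp L * real n powr (- \<rho>)"
    if n: "N \<le> n" and z: "z \<in> K" for n z
  proof
    show "f n z = g n * (1 + r n z)" using g[OF n] by (simp add: r_def)
    have n1: "1 \<le> real n" using n N by simp
    have \<rho>_le: "\<rho> \<le> \<sigma> - 3 / 2" "\<rho> \<le> 1 / 2" unfolding \<rho>(1) by (rule min.cobounded1, rule min.cobounded2)
    have "norm z * real n powr (3 / 2 - \<sigma>) + real n powr (- 1 / 2) \<le> R * real n powr (- \<rho>) + real n powr (- \<rho>)"
      using R z n1 \<rho>_le by (intro add_mono mult_mono powr_mono) auto
    from mult_left_mono[OF this C] have le: "C * (norm z * real n powr (3 / 2 - \<sigma>) + real n powr (- 1 / 2)) \<le> L * real n powr (- \<rho>)"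
      by (simp add: L_def distrib_left distrib_right mult.assoc)
    have "r n z = (f n z - g n) / g n" using g[OF n] by (simp add: r_def diff_divide_distrib)
    then have "norm (r n z) \<le> exp (C * (norm z * real n powr (3 / 2 - \<sigma>) + real n powr (- 1 / 2))) - 1"
      using f[OF n, of z] g[OF n] by (simp add: norm_divide pos_divide_le_eq mult.commute)
    also have "\<dots> \<le> exp (L * real n powr (- \<rho>)) - 1" using le by simp
    also have "\<dots> \<le> L * real n powr (- \<rho>) * exp (L * real n powr (- \<rho>))" by (rule exp_minus_one_le)
    also have "\<dots> \<le> L * real n powr (- \<rho>) * exp (L * 1)"
      using C R(1) powr_mono[of "- \<rho>" 0 "real n"] n1 \<rho>(2)
      by (intro mult_left_mono) (auto simp: L_def intro!: mult_left_le)
    finally show "norm (r n z) \<le> L * exp L * real n powr (- \<rho>)" by (simp add: mult_ac)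
  qed
  then show "\<exists>r C. \<forall>\<^sub>F n in sequentially. \<forall>z\<in>K.
      f n z = g n * (1 + r n z) \<and> norm (r n z) \<le> C * real n powr (- \<rho>)"
    unfolding eventually_sequentially
    by (intro exI[of _ r] exI[of _ "L * exp L"] exI[of _ N] allI impI ballI)
qed

section \<open>Entire solutions with the prescribed asymptotics and type\<close>

theorem theorem2p1:
  fixes a b :: "nat \<Rightarrow> real" and \<alpha> \<beta> \<gamma> \<sigma> \<nu> \<tau> \<rho> :: real
  assumes a_pos: "\<And>n. a n > 0"
    and a_asymp: "\<exists>r. r \<in> O(\<lambda>n. real n powr (- 2)) \<and>
      (\<forall>\<^sub>F n in sequentially. a n = real n powr \<sigma> * (1 + \<alpha> * real n powr (- 1) + r n))"
    and b_asymp: "\<exists>r. r \<in> O(\<lambda>n. real n powr (- 2)) \<and>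
      (\<forall>\<^sub>F n in sequentially. b n = 2 * \<gamma> * real n powr \<sigma> * (1 + \<beta> * real n powr (- 1) + r n))"
    and \<gamma>: "\<bar>\<gamma>\<bar> = 1"
    and \<sigma>: "\<sigma> > 3 / 2"
    and \<nu>: "\<nu> = - sgn \<gamma>"
    and \<tau>: "\<tau> = 2 * \<beta> - 2 * \<alpha> + \<sigma>"
    and \<rho>: "\<rho> = min (\<sigma> - 3 / 2) (1 / 2)"
  shows "\<exists>f :: int \<Rightarrow> complex \<Rightarrow> complex.
    (\<forall>z. jacobi_solution a b z (\<lambda>k. f k z)) \<and>
    (\<tau> < 0 \<longrightarrow> asymp_unif_on_compacts (\<lambda>n. f (int n))
       (\<lambda>n. of_real (\<nu> ^ n * real n powr (- \<sigma> / 2 + 1 / 4)) *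
            exp (- 2 * \<i> * of_real (sqrt (\<bar>\<tau>\<bar> * real n)))) \<rho>) \<and>
    (\<tau> > 0 \<longrightarrow> asymp_unif_on_compacts (\<lambda>n. f (int n))
       (\<lambda>n. of_real (\<nu> ^ n * real n powr (- \<sigma> / 2 + 1 / 4) *
            exp (- 2 * sqrt (\<tau> * real n)))) \<rho>) \<and>
    (\<forall>n::nat. f (int n) holomorphic_on UNIV \<and> minimal_exponential_type (f (int n)))"
proof (cases "\<tau> = 0")
  case True
  have "minimal_exponential_type (\<lambda>_. 0)"
    by (auto simp: minimal_exponential_type_def intro!: exI[of _ 0])
  with True show ?thesis
    by (intro exI[of _ "\<lambda>_ _. 0"]) (auto simp: jacobi_solution_def)
next
  case False
  \<comment> \<open>The square root of \<tau> with nonnegative real part; it is imaginary when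
    \<tau> < 0, which merges both asymptotic forms into one ansatz.\<close>
  define s where "s = (if \<tau> > 0 then of_real (sqrt \<tau>) else \<i> * of_real (sqrt \<bar>\<tau>\<bar>))"
  have s: "s ^ 2 = of_real (2 * \<beta> - 2 * \<alpha> + \<sigma>)" "s \<noteq> 0" "0 \<le> Re s"
  proof -
    have "s ^ 2 = of_real \<tau>"
      by (simp add: s_def power_mult_distrib flip: of_real_power)
    then show "s ^ 2 = of_real (2 * \<beta> - 2 * \<alpha> + \<sigma>)" unfolding \<tau> .
    show "s \<noteq> 0" "0 \<le> Re s" using False by (auto simp: s_def)
  qed
  define p where "p = 1 / 4 - \<sigma> / 2"
  then have p_eq: "p = - \<sigma> / 2 + 1 / 4" by simp
  define g where "g n = of_real (\<nu> ^ n) * ansatz p s n" for n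
  \<comment> \<open>This sign identity normalises the diagonal to leading term n^\<sigma>.\<close>
  have \<nu>\<gamma>: "- \<nu> * \<gamma> = 1" using \<gamma> unfolding \<nu> by (auto simp: abs_if sgn_if split: if_splits)
  have \<nu>_sq: "\<nu> ^ 2 = 1" using \<gamma> unfolding \<nu> by (auto simp: sgn_if)
  have "\<exists>r. r \<in> O(\<lambda>n. real n powr (- 2)) \<and>
      (\<forall>\<^sub>F n in sequentially. - \<nu> * b n / 2 = real n powr \<sigma> * (1 + \<beta> * real n powr (- 1) + r n))"
  proof -
    obtain r where r: "r \<in> O(\<lambda>n. real n powr (- 2))" and
      b: "\<forall>\<^sub>F n in sequentially. b n = 2 * \<gamma> * real n powr \<sigma> * (1 + \<beta> * real n powr (- 1) + r n)"
      using b_asymp by blast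
    from b have "\<forall>\<^sub>F n in sequentially. - \<nu> * b n / 2 = real n powr \<sigma> * (1 + \<beta> * real n powr (- 1) + r n)"
    proof eventually_elim
      case (elim n)
      have "- \<nu> * b n / 2 = (- \<nu> * \<gamma>) * (real n powr \<sigma> * (1 + \<beta> * real n powr (- 1) + r n))"
        unfolding elim by simp
      then show ?case unfolding \<nu>\<gamma> by simp
    qed
    with r show ?thesis by blast
  qed
  from truncated_solution_bound[OF a_pos a_asymp this \<sigma> \<nu>_sq p_def s, folded g_def]
  obtain N C where N: "1 < N" and C: "0 \<le> C" and
    bound: "\<And>z M v n. jacobi_solution a b z v \<Longrightarrow> v (int M) = g M \<Longrightarrow> v (int (Suc M)) = g (Suc M) \<Longrightarrow>
      N \<le> n \<Longrightarrow> n \<le> M \<Longrightarrow> norm (v (int n) - g n) \<le>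
        norm (g n) * (exp (C * (norm z * real n powr (3 / 2 - \<sigma>) + real n powr (- 1 / 2))) - 1)"
    by blast
  \<comment> \<open>The bound as a function of |z| alone, increasing because
    \<open>0 \<le> C\<close>.\<close>
  define B where "B n x = norm (g n) *
      (exp (C * (x * real n powr (3 / 2 - \<sigma>) + real n powr (- 1 / 2))) - 1)" for n and x :: real
  have B_mono: "mono (B n)" for n
    unfolding B_def using C by (auto intro!: monoI mult_left_mono mult_right_mono)
  have B_bound: "norm (v (int n) - g n) \<le> B n (norm z)"
    if "jacobi_solution a b z v" "v (int M) = g M" "v (int (Suc M)) = g (Suc M)" "N \<le> n" "n \<le> M" for z M v n
    unfolding B_def by (rule bound[OF that])
  have "\<exists>f. (\<forall>z. jacobi_solution a b z (\<lambda>k. f k z)) \<and> (\<forall>n. f (int n) holomorphic_on UNIV) \<and>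
      (\<forall>n\<ge>N. \<forall>z. norm (f (int n) z - g n) \<le> B n (norm z))"
    by (rule jacobi_limit_solution[where a = a and b = b and g = g and N = N and B = B])
       (fact a_pos, fact B_bound, fact B_mono)
  then obtain f where f: "\<And>z. jacobi_solution a b z (\<lambda>k. f k z)" "\<And>n. f (int n) holomorphic_on UNIV"
    "\<And>n z. N \<le> n \<Longrightarrow> norm (f (int n) z - g n) \<le>
        norm (g n) * (exp (C * (norm z * real n powr (3 / 2 - \<sigma>) + real n powr (- 1 / 2))) - 1)"
    unfolding B_def by blast
  have \<nu>_nz: "\<nu> \<noteq> 0" using \<nu>_sq by auto
  have g_nz: "g n \<noteq> 0" if "N \<le> n" for n
    using ansatz_nonzero[of n p s] \<nu>_nz that N by (auto simp: g_def)
  have asymp: "asymp_unif_on_compacts (\<lambda>n. f (int n)) g \<rho>"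
    by (rule asymp_unif_on_compactsI[OF \<rho> _ C _ g_nz f(3)]) (use \<sigma> N in \<open>auto simp: \<rho>\<close>)
  have "minimal_exponential_type (f (int n))" for n
  proof (rule jacobi_solution_minimal_type[OF a_pos f(1)])
    show "norm (f (int n) z) \<le> norm (g n) * exp (C * real n powr (- 1 / 2)) *
        exp (C * real n powr (3 / 2 - \<sigma>) * norm z)" if "N \<le> n" for n z
    proof -
      have "norm (f (int n) z) \<le> norm (g n) *
          exp (C * (norm z * real n powr (3 / 2 - \<sigma>) + real n powr (- 1 / 2)))"
        using f(3)[OF that, of z] norm_triangle_sub[of "f (int n) z" "g n"] by (simp add: algebra_simps)
      also have "\<dots> = norm (g n) * exp (C * real n powr (- 1 / 2)) * exp (C * real n powr (3 / 2 - \<sigma>) * norm z)"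
        by (simp add: algebra_simps flip: exp_add)
      finally show ?thesis .
    qed
    \<comment> \<open>The exponential rate available at index n; it tends to 0 because \<sigma> >
      3/2.\<close>
    have "(\<lambda>n. C * real n powr (3 / 2 - \<sigma>)) \<longlonglongrightarrow> C * 0"
      using \<sigma> by (intro tendsto_mult tendsto_const tendsto_neg_powr filterlim_real_sequentially) auto
    then show "(\<lambda>n. C * real n powr (3 / 2 - \<sigma>)) \<longlonglongrightarrow> 0" by simp
  qed
  moreover have "g = (\<lambda>n. of_real (\<nu> ^ n * real n powr (- \<sigma> / 2 + 1 / 4)) *
            exp (- 2 * \<i> * of_real (sqrt (\<bar>\<tau>\<bar> * real n))))" if "\<tau> < 0"
  proof
    fix n
    have "s * of_real (sqrt (real n)) = \<i> * of_real (sqrt (\<bar>\<tau>\<bar> * real n))"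
      unfolding s_def real_sqrt_mult of_real_mult using that by simp
    then show "g n = of_real (\<nu> ^ n * real n powr (- \<sigma> / 2 + 1 / 4)) *
        exp (- 2 * \<i> * of_real (sqrt (\<bar>\<tau>\<bar> * real n)))"
      by (simp only: g_def ansatz_def p_eq of_real_mult mult.assoc)
  qed
  moreover have "g = (\<lambda>n. of_real (\<nu> ^ n * real n powr (- \<sigma> / 2 + 1 / 4) *
            exp (- 2 * sqrt (\<tau> * real n))))" if "\<tau> > 0"
  proof
    fix n
    have "s * of_real (sqrt (real n)) = of_real (sqrt (\<tau> * real n))"
      unfolding s_def real_sqrt_mult of_real_mult using that by simp
    moreover have "exp (- 2 * of_real y) = (of_real (exp (- 2 * y)) :: complex)" for y
      by (simp flip: exp_of_real)
    ultimately show "g n = of_real (\<nu> ^ n * real n powr (- \<sigma> / 2 + 1 / 4) * exp (- 2 * sqrt (\<tau> * real n)))"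
      by (simp only: g_def ansatz_def p_eq of_real_mult mult.assoc)
  qed
  ultimately show ?thesis
    using f(1,2) asymp by (intro exI[of _ f] conjI allI impI) simp_all
qed

end
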